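(* Let $\Omega$ be a bounded convex domain in $\mathbb{C}^d$. Suppose that there exists a compact subset $S\subset\partial\Omega$ such that $S_a$, the set of limit points of $S$, is a finite set, and such that every $p\in\partial\Omega\setminus S$ is a $\mathcal{C}^{1,\mathrm{Dini}}$-smooth $\mathbb{C}$-strictly convex boundary point. Let $f:\mathbb{D}\to\Omega$ be a complex geodesic. Then $f$ extends continuously to $\overline{\mathbb{D}}$.
   Context: $\mathbb{D}$ is the open unit disk in $\mathbb{C}$. A complex geodesic $f:\mathbb{D}\to\Omega$ is a holomorphic map that is an isometric embedding for the Kobayashi distances: $\mathsf{k}_\Omega(f(z),f(w))=\mathsf{k}_{\mathbb{D}}(z,w)$ for all $z,w\in\mathbb{D}$. For a $\mathcal{C}^1$-smooth boundary point $p$ of $\Omega$, let $T_p(\partial\Omega)$ be the real tangent space, viewed as a real hyperplane (through $0$) in $\mathbb{C}^d$, and $H_p(\partial\Omega):=T_p(\partial\Omega)\cap i\,T_p(\partial\Omega)$ the complex tangent space. Such a point $p$ of a convex domain $\Omega$ is a $\mathbb{C}$-strictly convex boundary point if $(p+H_p(\partial\Omega))\cap\overline\Omega=\{p\}$. (Equivalently: for every complex affine line $L$ with $p\in L$ and $L\cap\Omega=\emptyset$, $(L\cap\partial\Omega)\setminus\{p\}=\emptyset$.) A boundary point $p$ is $\mathcal{C}^{1,\mathrm{Dini}}$-smooth if $\partial\Omega$ is $\mathcal{C}^1$-smooth near $p$ and the inner unit normal $x\mapsto n_x$ to $\partial\Omega$ is Dini-continuous near $p$: there is a neighbourhood $U$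 of $p$ such that $\int_0^1\omega(t)\,\frac{dt}{t}<\infty$, where $\omega(t)=\sup\{\|n_x-n_y\|: x,y\in\partial\Omega\cap U,\ \|x-y\|<t\}$. *)

theory Defs
  imports "HOL-Complex_Analysis.Complex_Analysis"
begin

no_notation fps_nth (infixl \<open>$\<close> 75)

section \<open>The Kobayashi distance and complex geodesics\<close>

definition holomorphic_disc :: "(complex ^ 'n) set \<Rightarrow> (complex \<Rightarrow> complex ^ 'n) \<Rightarrow> bool" where
  "holomorphic_disc \<Omega> \<phi> \<longleftrightarrow>
     (\<forall>i. (\<lambda>z. \<phi> z $ i) holomorphic_on ball 0 1) \<and> \<phi> ` ball 0 1 \<subseteq> \<Omega>"

text \<open>The Poincare distance of the unit disc, which is its Kobayashi distance
  (see \<open>kobayashi_dist_unit_disc\<close> below). The normalisation does not affect the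
  notion of complex geodesic.\<close>

definition poincare_dist :: "complex \<Rightarrow> complex \<Rightarrow> real" where
  "poincare_dist z w = artanh (norm ((z - w) / (1 - cnj w * z)))"

text \<open>Infimum of the Poincare lengths of finite chains of holomorphic discs in \<open>\<Omega>\<close>. It is only
  meaningful for a connected open \<open>\<Omega>\<close>, where chains between any two points exist.\<close>

definition kobayashi_dist :: "(complex ^ 'n) set \<Rightarrow> complex ^ 'n \<Rightarrow> complex ^ 'n \<Rightarrow> real" where
  "kobayashi_dist \<Omega> x y =
     Inf {(\<Sum>j<m. poincare_dist (a j) (b j)) | m p \<phi> a b.
            m > 0 \<and> p 0 = x \<and> p m = y \<and>
            (\<forall>j<m. holomorphic_disc \<Omega> (\<phi> j) \<and> a j \<in> ball 0 1 \<and> b j \<in> ball 0 1 \<and>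
                   \<phi> j (a j) = p j \<and> \<phi> j (b j) = p (Suc j))}"

definition complex_geodesic :: "(complex ^ 'n) set \<Rightarrow> (complex \<Rightarrow> complex ^ 'n) \<Rightarrow> bool" where
  "complex_geodesic \<Omega> f \<longleftrightarrow> holomorphic_disc \<Omega> f \<and>
     (\<forall>z\<in>ball 0 1. \<forall>w\<in>ball 0 1. kobayashi_dist \<Omega> (f z) (f w) = poincare_dist z w)"

lemma artanh_mono:
  assumes "0 \<le> x" "x \<le> y" "y < (1::real)"
  shows "artanh x \<le> artanh y"
  unfolding artanh_def using assms by (auto intro!: frac_le divide_pos_pos)

lemma pseudo_dist_less_1:
  assumes "norm z < 1" "norm w < 1"
  shows "norm ((z - w) / (1 - cnj w * z)) < 1"
  using Moebius_function_norm_lt_1[of w z 0] assms by (simp add: Moebius_function_simple)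

lemma poincare_dist_nonneg:
  assumes "norm z < 1" "norm w < 1"
  shows "0 \<le> poincare_dist z w"
  using artanh_mono[of 0 "norm ((z - w) / (1 - cnj w * z))"] pseudo_dist_less_1[OF assms]
  unfolding poincare_dist_def by simp

lemma Schwarz_Pick_poincare_dist:
  assumes hol: "\<phi> holomorphic_on ball 0 1"
    and im: "\<And>z. norm z < 1 \<Longrightarrow> norm (\<phi> z) < 1"
    and a: "norm a < 1" and b: "norm b < 1"
  shows "poincare_dist (\<phi> a) (\<phi> b) \<le> poincare_dist a b"
proof -
  define F where "F = Moebius_function 0 (\<phi> b) \<circ> \<phi> \<circ> Moebius_function 0 (-b)"
  define u where "u = Moebius_function 0 b a"
  have nb: "norm (-b) < 1" using b by simp
  have u: "norm u < 1" unfolding u_def by (rule Moebius_function_norm_lt_1[OF b a])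
  have inv: "Moebius_function 0 (-b) u = a"
    unfolding u_def by (rule Moebius_function_compose) (use a b in auto)
  have m1: "Moebius_function 0 (-b) ` ball 0 1 \<subseteq> ball 0 1"
    using Moebius_function_norm_lt_1[OF nb] by auto
  have "F holomorphic_on ball 0 1"
    unfolding F_def
    by (intro holomorphic_on_compose_gen[OF Moebius_function_holomorphic[OF nb] _ m1]
        holomorphic_on_compose_gen[OF hol Moebius_function_holomorphic[OF im[OF b]]]) (use im in auto)
  moreover have "F 0 = 0"
    unfolding F_def by (simp add: Moebius_function_simple)
  moreover have "norm (F z) < 1" if "norm z < 1" for z
    unfolding F_def using Moebius_function_norm_lt_1 im nb b that by (simp del: norm_minus_cancel)
  ultimately have "norm (F u) \<le> norm u"
    using Schwarz_Lemma(1)[of F u] u by blast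
  then have "norm (Moebius_function 0 (\<phi> b) (\<phi> a)) \<le> norm (Moebius_function 0 b a)"
    unfolding F_def using inv by (simp add: u_def)
  then show ?thesis
    unfolding poincare_dist_def Moebius_function_simple
    by (intro artanh_mono pseudo_dist_less_1 a b) auto
qed

lemma poincare_dist_triangle_0:
  assumes u: "norm u < 1" and v: "norm v < 1"
  shows "poincare_dist u v \<le> artanh (norm u) + artanh (norm v)"
proof -
  define r s where "r = norm u" and "s = norm v"
  have rs: "0 \<le> r" "r < 1" "0 \<le> s" "s < 1" using u v by (auto simp: r_def s_def)
  define c where "c = Re (cnj v * u)"
  have rs1: "r * s < 1" using mult_left_mono[of s 1 r] rs by simp
  have "\<bar>c\<bar> \<le> norm (cnj v * u)" unfolding c_def by (rule abs_Re_le_cmod)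
  then have c: "c + r * s \<ge> 0" by (simp add: norm_mult r_def s_def mult.commute)
  have nz: "1 - cnj v * u \<noteq> 0"
  proof
    assume "1 - cnj v * u = 0"
    then have "norm (cnj v * u) = 1" by simp
    then show False using rs1 by (simp add: norm_mult r_def s_def mult.commute)
  qed
  have e1: "norm (u - v) ^ 2 = r\<^sup>2 + s\<^sup>2 - 2 * c"
    unfolding r_def s_def c_def cmod_power2 by (simp add: power2_eq_square algebra_simps)
  have e2: "norm (1 - cnj v * u) ^ 2 = 1 + r\<^sup>2 * s\<^sup>2 - 2 * c"
    unfolding r_def s_def c_def cmod_power2 by (simp add: power2_eq_square algebra_simps)
  have "(r + s)\<^sup>2 \<le> (1 + r * s)\<^sup>2"
  proof (rule power_mono)
    have "0 \<le> (1 - r) * (1 - s)" using rs by simp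
    then show "r + s \<le> 1 + r * s" by (simp add: algebra_simps)
  qed (use rs in auto)
  then have "0 \<le> 2 * (c + r * s) * ((1 + r * s)\<^sup>2 - (r + s)\<^sup>2)" using c by simp
  also have "\<dots> = ((r + s) * norm (1 - cnj v * u))\<^sup>2 - (norm (u - v) * (1 + r * s))\<^sup>2"
    unfolding power_mult_distrib e1 e2 by (simp add: power2_eq_square algebra_simps)
  finally have "norm (u - v) * (1 + r * s) \<le> (r + s) * norm (1 - cnj v * u)"
    by - (rule power2_le_imp_le, use rs in simp_all)
  moreover have "norm (1 - cnj v * u) > 0" "1 + r * s > 0"
    using nz rs by (simp_all add: add_pos_nonneg)
  ultimately have le: "norm ((u - v) / (1 - cnj v * u)) \<le> (r + s) / (1 + r * s)"
    unfolding norm_divide by (metis pos_divide_le_eq pos_le_divide_eq times_divide_eq_left)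
  have lt: "(r + s) / (1 + r * s) < 1"
  proof -
    have "0 < (1 - r) * (1 - s)" using rs by simp
    then show ?thesis using rs by (simp add: divide_less_eq add_pos_nonneg algebra_simps)
  qed
  have "artanh ((r + s) / (1 + r * s)) = artanh r + artanh s"
  proof -
    have p: "1 + r * s > 0" using rs by (simp add: add_pos_nonneg)
    have "1 + (r + s) / (1 + r * s) = (1 + r) * (1 + s) / (1 + r * s)"
      "1 - (r + s) / (1 + r * s) = (1 - r) * (1 - s) / (1 + r * s)"
      using p by (simp_all add: field_simps)
    then have "(1 + (r + s) / (1 + r * s)) / (1 - (r + s) / (1 + r * s))
        = ((1 + r) / (1 - r)) * ((1 + s) / (1 - s))" using p by simp
    then have "artanh ((r + s) / (1 + r * s)) = ln (((1 + r) / (1 - r)) * ((1 + s) / (1 - s))) / 2"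
      unfolding artanh_def by (rule arg_cong)
    also have "\<dots> = (ln ((1 + r) / (1 - r)) + ln ((1 + s) / (1 - s))) / 2"
      by (subst ln_mult_pos) (use rs in auto)
    finally show ?thesis unfolding artanh_def by (simp only: add_divide_distrib)
  qed
  with artanh_mono[OF _ le lt] show ?thesis by (simp add: poincare_dist_def r_def s_def)
qed

lemma poincare_dist_triangle:
  assumes a: "norm a < 1" and b: "norm b < 1" and c: "norm c < 1"
  shows "poincare_dist a c \<le> poincare_dist a b + poincare_dist b c"
proof -
  define u v where "u = Moebius_function 0 b a" and "v = Moebius_function 0 b c"
  have nb: "norm (-b) < 1" using b by simp
  have uv: "norm u < 1" "norm v < 1"
    unfolding u_def v_def using Moebius_function_norm_lt_1 a b c by auto
  have inv: "Moebius_function 0 (-b) u = a" "Moebius_function 0 (-b) v = c"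
    unfolding u_def v_def by (rule Moebius_function_compose; use a b c in auto)+
  have "poincare_dist (Moebius_function 0 (-b) u) (Moebius_function 0 (-b) v) \<le> poincare_dist u v"
    by (rule Schwarz_Pick_poincare_dist[OF Moebius_function_holomorphic[OF nb]
          Moebius_function_norm_lt_1[OF nb] uv])
  also have "\<dots> \<le> artanh (norm u) + artanh (norm v)"
    by (rule poincare_dist_triangle_0[OF uv])
  also have "norm v = norm ((b - c) / (1 - cnj c * b))"
  proof -
    have "norm (1 - cnj b * c) = norm (cnj (1 - cnj b * c))" by (rule complex_mod_cnj[symmetric])
    then show ?thesis
      unfolding v_def Moebius_function_simple by (simp add: norm_divide norm_minus_commute mult.commute)
  qed
  finally show ?thesis
    unfolding inv by (simp add: poincare_dist_def u_def Moebius_function_simple)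
qed

lemma kobayashi_dist_unit_disc:
  assumes "z \<in> ball 0 1" "w \<in> ball 0 1"
  shows "kobayashi_dist (ball 0 1 :: (complex ^ 1) set) (vec z) (vec w) = poincare_dist z w"
  unfolding kobayashi_dist_def
proof (rule cInf_eq_minimum)
  have n1: "norm v = norm (v $ 1)" for v :: "complex ^ 1"
    by (simp add: norm_vec_def L2_set_def)
  have "holomorphic_disc (ball 0 1) (vec :: complex \<Rightarrow> complex ^ 1)"
    by (auto simp: holomorphic_disc_def n1)
  then show "poincare_dist z w \<in> {(\<Sum>j<m. poincare_dist (a j) (b j)) | m p \<phi> a b.
            m > 0 \<and> p 0 = (vec z :: complex ^ 1) \<and> p m = vec w \<and>
            (\<forall>j<m. holomorphic_disc (ball 0 1) (\<phi> j) \<and> a j \<in> ball 0 1 \<and> b j \<in> ball 0 1 \<and>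
                   \<phi> j (a j) = p j \<and> \<phi> j (b j) = p (Suc j))}"
    using assms
    by (intro CollectI exI[of _ "1::nat"] exI[of _ "\<lambda>j. if j = 0 then vec z else vec w"]
        exI[of _ "\<lambda>_. vec"] exI[of _ "\<lambda>_. z"] exI[of _ "\<lambda>_. w"]) auto
next
  fix l
  assume "l \<in> {(\<Sum>j<m. poincare_dist (a j) (b j)) | m p \<phi> a b.
            m > 0 \<and> p 0 = (vec z :: complex ^ 1) \<and> p m = vec w \<and>
            (\<forall>j<m. holomorphic_disc (ball 0 1) (\<phi> j) \<and> a j \<in> ball 0 1 \<and> b j \<in> ball 0 1 \<and>
                   \<phi> j (a j) = p j \<and> \<phi> j (b j) = p (Suc j))}"
  then obtain m p \<phi> a b where l: "l = (\<Sum>j<m. poincare_dist (a j) (b j))"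
    and p: "p 0 = (vec z :: complex ^ 1)" "p m = vec w"
    and ch: "\<And>j. j < m \<Longrightarrow> holomorphic_disc (ball 0 1) (\<phi> j) \<and> a j \<in> ball 0 1 \<and> b j \<in> ball 0 1 \<and>
                   \<phi> j (a j) = p j \<and> \<phi> j (b j) = p (Suc j)"
    by blast
  have n1: "norm v = norm (v $ 1)" for v :: "complex ^ 1"
    by (simp add: norm_vec_def L2_set_def)
  have step: "norm (p j $ 1) < 1 \<and> norm (p (Suc j) $ 1) < 1 \<and>
      poincare_dist (p j $ 1) (p (Suc j) $ 1) \<le> poincare_dist (a j) (b j)" if "j < m" for j
  proof -
    have "norm (\<phi> j \<zeta> $ 1) < 1" if "norm \<zeta> < 1" for \<zeta>
      using ch[OF \<open>j < m\<close>] that unfolding holomorphic_disc_def n1[symmetric] by fastforce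
    from this this[of "a j"] this[of "b j"] show ?thesis
      using Schwarz_Pick_poincare_dist[of "\<lambda>z. \<phi> j z $ 1" "a j" "b j"] ch[OF \<open>j < m\<close>]
      by (simp add: holomorphic_disc_def)
  qed
  have "norm (p k $ 1) < 1 \<and>
      poincare_dist (p 0 $ 1) (p k $ 1) \<le> (\<Sum>j<k. poincare_dist (a j) (b j))" if "k \<le> m" for k
    using that
  proof (induction k)
    case 0
    then show ?case using p assms by (simp add: poincare_dist_def)
  next
    case (Suc k)
    have "norm (p 0 $ 1) < 1" using p assms by simp
    then show ?case
      using Suc step[of k] poincare_dist_triangle[of "p 0 $ 1" "p k $ 1" "p (Suc k) $ 1"] by simp
  qed
  from this[of m] show "poincare_dist z w \<le> l" using p l by simp
qed


section \<open>Boundary regularity\<close>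

text \<open>\<open>g\<close> is the gradient of the local defining function \<open>\<rho>\<close>; it follows from \<open>g x \<noteq> 0\<close> that
  \<open>frontier \<Omega> \<inter> U = {x\<in>U. \<rho> x = 0}\<close>.\<close>

definition C1_defining_function ::
    "'a::euclidean_space set \<Rightarrow> 'a \<Rightarrow> 'a set \<Rightarrow> ('a \<Rightarrow> real) \<Rightarrow> ('a \<Rightarrow> 'a) \<Rightarrow> bool" where
  "C1_defining_function \<Omega> p U \<rho> g \<longleftrightarrow>
     open U \<and> p \<in> U \<and> continuous_on U g \<and>
     (\<forall>x\<in>U. (\<rho> has_derivative (\<lambda>v. g x \<bullet> v)) (at x) \<and> g x \<noteq> 0) \<and>
     \<Omega> \<inter> U = {x\<in>U. \<rho> x < 0}"

definition C1_smooth_at :: "'a::euclidean_space set \<Rightarrow> 'a \<Rightarrow> bool" where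
  "C1_smooth_at \<Omega> p \<longleftrightarrow> p \<in> frontier \<Omega> \<and> (\<exists>U \<rho> g. C1_defining_function \<Omega> p U \<rho> g)"

text \<open>Unique by \<open>inner_unit_normal_eq\<close> below; unspecified where the boundary is not \<open>C\<^sup>1\<close>.\<close>

definition inner_unit_normal :: "'a::euclidean_space set \<Rightarrow> 'a \<Rightarrow> 'a" where
  "inner_unit_normal \<Omega> x =
     (THE n. \<exists>U \<rho> g. C1_defining_function \<Omega> x U \<rho> g \<and> n = - (g x /\<^sub>R norm (g x)))"

lemma C1_defining_function_zero:
  assumes "C1_defining_function \<Omega> p U \<rho> g" and p: "p \<in> frontier \<Omega>"
  shows "\<rho> p = 0"
proof -
  have U: "open U" "p \<in> U" and eq: "\<Omega> \<inter> U = {x\<in>U. \<rho> x < 0}"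
    and der: "\<And>x. x \<in> U \<Longrightarrow> (\<rho> has_derivative (\<lambda>v. g x \<bullet> v)) (at x)"
    using assms(1) by (auto simp: C1_defining_function_def)
  have cont: "continuous_on U \<rho>"
    by (meson continuous_at_imp_continuous_on der has_derivative_continuous)
  have o: "open (U \<inter> \<rho> -` {..<0})" "open (U \<inter> \<rho> -` {0<..})"
    using cont U by (auto intro: continuous_open_preimage)
  have "\<not> \<rho> p < 0"
  proof
    assume "\<rho> p < 0"
    then have "p \<in> interior \<Omega>"
      using o(1) U eq by (intro interiorI[of "U \<inter> \<rho> -` {..<0}"]) auto
    then show False using p by (simp add: frontier_def)
  qed
  moreover have "\<not> \<rho> p > 0"
  proof
    assume "\<rho> p > 0"
    moreover have "\<Omega> \<inter> (U \<inter> \<rho> -` {0<..}) = {}"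
    proof (rule equals0I)
      fix x
      assume "x \<in> \<Omega> \<inter> (U \<inter> \<rho> -` {0<..})"
      then have "x \<in> \<Omega> \<inter> U" and "\<rho> x > 0" by auto
      then show False unfolding eq by simp
    qed
    ultimately have "p \<notin> closure \<Omega>"
      using o(2) U open_Int_closure_eq_empty[OF o(2), of \<Omega>] by (auto simp: Int_commute)
    then show False using p by (simp add: frontier_def)
  qed
  ultimately show ?thesis by simp
qed

lemma inner_unit_normal_eq:
  assumes 1: "C1_defining_function \<Omega> p U \<rho> g" and p: "p \<in> frontier \<Omega>"
  shows "inner_unit_normal \<Omega> p = - (g p /\<^sub>R norm (g p))"
  unfolding inner_unit_normal_def
proof (rule the_equality)
  show "\<exists>U \<rho> g'. C1_defining_function \<Omega> p U \<rho> g' \<and>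
      - (g p /\<^sub>R norm (g p)) = - (g' p /\<^sub>R norm (g' p))"
    using 1 by blast
next
  fix n
  assume "\<exists>U \<rho> g. C1_defining_function \<Omega> p U \<rho> g \<and> n = - (g p /\<^sub>R norm (g p))"
  then obtain V \<sigma> h where 2: "C1_defining_function \<Omega> p V \<sigma> h" and n: "n = - (h p /\<^sub>R norm (h p))"
    by blast
  have line: "((\<lambda>t. \<tau> (p + t *\<^sub>R v)) has_real_derivative k p \<bullet> v) (at 0)"
    if "C1_defining_function \<Omega> p W \<tau> k" for W \<tau> k v
  proof -
    have "(\<tau> has_derivative (\<lambda>v. k p \<bullet> v)) (at (p + 0 *\<^sub>R v))"
      using that by (auto simp: C1_defining_function_def)
    moreover have "((\<lambda>t. p + t *\<^sub>R v) has_derivative (\<lambda>t. t *\<^sub>R v)) (at 0)"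
      by (auto intro!: derivative_eq_intros)
    ultimately have "((\<lambda>t. \<tau> (p + t *\<^sub>R v)) has_derivative (\<lambda>t. k p \<bullet> (t *\<^sub>R v))) (at 0)"
      using has_derivative_compose[of "\<lambda>t. p + t *\<^sub>R v" "\<lambda>t. t *\<^sub>R v" 0 UNIV \<tau> "\<lambda>v. k p \<bullet> v"] by simp
    then show ?thesis
      by (rule has_derivative_imp_has_field_derivative) simp
  qed
  have nbhd: "\<forall>\<^sub>F t in at_right 0. p + t *\<^sub>R v \<in> W" if "C1_defining_function \<Omega> p W \<tau> k" for W \<tau> k v
  proof -
    have "((\<lambda>t. p + t *\<^sub>R v) \<longlongrightarrow> p + 0 *\<^sub>R v) (at_right 0)"
      by (intro tendsto_intros)
    then show ?thesis
      using that by (intro topological_tendstoD) (auto simp: C1_defining_function_def)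
  qed
  have key: "h p \<bullet> v \<le> 0" if v: "g p \<bullet> v < 0" for v
  proof (rule ccontr)
    assume "\<not> h p \<bullet> v \<le> 0"
    then have v': "0 < h p \<bullet> v" by simp
    obtain d where "d > 0" and d: "\<And>t. 0 < t \<Longrightarrow> t < d \<Longrightarrow> \<rho> (p + t *\<^sub>R v) < 0"
      using DERIV_neg_dec_right[OF line[OF 1] v] C1_defining_function_zero[OF 1 p] by auto
    obtain e where "e > 0" and e: "\<And>t. 0 < t \<Longrightarrow> t < e \<Longrightarrow> \<sigma> (p + t *\<^sub>R v) > 0"
      using DERIV_pos_inc_right[OF line[OF 2] v'] C1_defining_function_zero[OF 2 p] by auto
    have "\<forall>\<^sub>F t in at_right (0::real). 0 < t \<and> t < min d e"
      using \<open>d > 0\<close> \<open>e > 0\<close> by (auto simp: eventually_at_right_field intro!: exI[of _ "min d e"])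
    then have "\<forall>\<^sub>F t in at_right (0::real). False"
      using nbhd[OF 1, of v] nbhd[OF 2, of v]
    proof eventually_elim
      case (elim t)
      then have "p + t *\<^sub>R v \<in> \<Omega>"
        using d[of t] 1 by (auto simp: C1_defining_function_def)
      then have "\<sigma> (p + t *\<^sub>R v) < 0"
        using elim 2 by (auto simp: C1_defining_function_def)
      then show False using e[of t] elim by auto
    qed
    then show False by simp
  qed
  define a b where "a = g p /\<^sub>R norm (g p)" and "b = h p /\<^sub>R norm (h p)"
  have gh: "g p \<noteq> 0" "h p \<noteq> 0" using 1 2 by (auto simp: C1_defining_function_def)
  then have ab: "norm a = 1" "norm b = 1" by (simp_all add: a_def b_def)
  have "a = b"
  proof (rule ccontr)
    assume "a \<noteq> b"
    have "0 < norm (a - b) ^ 2" using \<open>a \<noteq> b\<close> by simp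
    also have "norm (a - b) ^ 2 = 2 - 2 * (a \<bullet> b)"
      using ab by (simp add: power2_norm_eq_inner inner_diff inner_commute norm_eq_1)
    finally have lt: "a \<bullet> b < 1" by simp
    have "a \<bullet> (b - a) < 0" "b \<bullet> (b - a) > 0"
      using lt ab by (simp_all add: inner_diff inner_commute norm_eq_1)
    then have "g p \<bullet> (b - a) < 0" "h p \<bullet> (b - a) > 0"
      using gh by (simp_all add: a_def b_def divide_simps zero_less_mult_iff mult_less_0_iff)
    with key show False by force
  qed
  then show "n = - (g p /\<^sub>R norm (g p))" using n by (simp add: a_def b_def)
qed

definition real_tangent_space :: "'a::euclidean_space set \<Rightarrow> 'a \<Rightarrow> 'a set" where
  "real_tangent_space \<Omega> p = {v. inner_unit_normal \<Omega> p \<bullet> v = 0}"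

definition complex_tangent_space :: "(complex ^ 'n) set \<Rightarrow> complex ^ 'n \<Rightarrow> (complex ^ 'n) set" where
  "complex_tangent_space \<Omega> p =
     real_tangent_space \<Omega> p \<inter> (\<lambda>v. \<i> *s v) ` real_tangent_space \<Omega> p"

definition C_strictly_convex_at :: "(complex ^ 'n) set \<Rightarrow> complex ^ 'n \<Rightarrow> bool" where
  "C_strictly_convex_at \<Omega> p \<longleftrightarrow>
     C1_smooth_at \<Omega> p \<and> (\<lambda>v. p + v) ` complex_tangent_space \<Omega> p \<inter> closure \<Omega> = {p}"

definition normal_modulus :: "'a::euclidean_space set \<Rightarrow> 'a set \<Rightarrow> real \<Rightarrow> ennreal" where
  "normal_modulus \<Omega> U t =
     Sup {ennreal (norm (inner_unit_normal \<Omega> x - inner_unit_normal \<Omega> y)) | x y.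
            x \<in> frontier \<Omega> \<inter> U \<and> y \<in> frontier \<Omega> \<inter> U \<and> norm (x - y) < t}"

definition C1_Dini_smooth_at :: "'a::euclidean_space set \<Rightarrow> 'a \<Rightarrow> bool" where
  "C1_Dini_smooth_at \<Omega> p \<longleftrightarrow> p \<in> frontier \<Omega> \<and>
     (\<exists>U. open U \<and> p \<in> U \<and> (\<forall>x\<in>frontier \<Omega> \<inter> U. C1_smooth_at \<Omega> x) \<and>
          (\<integral>\<^sup>+t\<in>{0<..<1}. (normal_modulus \<Omega> U t / ennreal t) \<partial>lborel) < \<infinity>)"

end

theory Submission
  imports Defs
begin

text \<open>Let \<open>\<delta>(x)\<close> be the distance from \<open>x\<close> to the boundary. Near a Dini-smooth point a chain
  of affine discs, each almost tangent to the boundary, shows that the Kobayashi distance from \<open>f 0\<close>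
  to \<open>x\<close> is at most \<open>ln (1 / \<delta>(x)) / 2 + O(1)\<close>; the errors of the links add up to the Dini integral.
  At a \<open>\<complex>\<close>-strictly convex point \<open>p\<close> the complex supporting functionals at boundary points close to \<open>p\<close>
  map the domain into a half-plane and stay away from \<open>0\<close> off a neighbourhood of \<open>p\<close>, so by Schwarz-Pick
  the distance from \<open>x\<close> near \<open>p\<close> to any point away from \<open>p\<close> is at least \<open>ln (1 / \<delta>(x)) / 2 - O(1)\<close>.
  Hence Gromov products of points near \<open>p\<close> with points near another such point \<open>q\<close> stay bounded, and
  \<open>p\<close>, \<open>q\<close> cannot both be cluster values of \<open>f\<close> at the same point of the circle. Cluster sets are
  connected, hence uncountable if they are not singletons, whereas \<open>S\<close> is countable.\<close>

section \<open>Normals of convex domains\<close>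

text \<open>Both distance bounds have leading term \<open>ln (1 / \<delta>) / 2\<close>, and they
  can be compared only because all errors are bounded. For a merely continuous normal the chain
  argument would leave an error \<open>o(ln (1 / \<delta>))\<close>, which is too weak; hence the
  summation over dyadic scales. Constants must also be uniform for \<open>x\<close> near
  \<open>p\<close>. Normals and functionals are therefore taken at the boundary point
  \<open>q\<close> nearest to \<open>x\<close>: there \<open>x - q\<close> is
  \<open>\<delta>\<close> times the normal, and the functional at \<open>q\<close> takes exactly the
  value \<open>\<delta>\<close> at \<open>x\<close>. Gromov products are not formed explicitly.
  Isometry enters as: \<open>artanh (norm z)\<close> is at most the length of any chain from
  \<open>f 0\<close> to \<open>f z\<close>, so \<open>\<delta>(f z)\<close> is at most a constant
  times \<open>1 - norm z\<close>. Schwarz-Pick for the functional composed with \<open>f\<close>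
  then keeps every \<open>\<zeta>\<close> with \<open>f \<zeta>\<close> away from \<open>p\<close>
  outside a thin horodisc at \<open>z\<close>. Nothing is asked of the boundary near
  \<open>f \<zeta>\<close>, which may be close to \<open>S\<close>. Two good cluster values are
  excluded by joining \<open>z\<close> to \<open>w\<close> inside the union of two such horodiscs:
  the image of the path must leave the neighbourhoods of both values.\<close>

lemma supporting_normal_unique:
  fixes \<Omega> :: "'a::euclidean_space set"
  assumes smooth: "C1_smooth_at \<Omega> y"
    and supp: "\<And>x. x \<in> \<Omega> \<Longrightarrow> 0 \<le> (x - y) \<bullet> \<nu>" and unit: "norm \<nu> = 1"
  shows "inner_unit_normal \<Omega> y = \<nu>"
proof -
  obtain U \<rho> g where y: "y \<in> frontier \<Omega>" and C1: "C1_defining_function \<Omega> y U \<rho> g"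
    using smooth by (auto simp: C1_smooth_at_def)
  have U: "open U" "y \<in> U" and eq: "\<Omega> \<inter> U = {x\<in>U. \<rho> x < 0}"
    and der: "(\<rho> has_derivative (\<lambda>v. g y \<bullet> v)) (at y)" and gnz: "g y \<noteq> 0"
    using C1 by (auto simp: C1_defining_function_def)
  \<comment> \<open>Such a \<open>v\<close> points into the domain, so \<open>\<nu>\<close> is
    nonnegative on an open half-space, which determines a unit vector. This identifies the
    \<open>THE\<close> in \<open>inner_unit_normal\<close> with normals found geometrically.\<close>
  have key: "0 \<le> v \<bullet> \<nu>" if v: "g y \<bullet> v < 0" for v
  proof -
    have "((\<lambda>t. y + t *\<^sub>R v) has_derivative (\<lambda>t. t *\<^sub>R v)) (at 0)"
      by (auto intro!: derivative_eq_intros)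
    then have "((\<lambda>t. \<rho> (y + t *\<^sub>R v)) has_derivative (\<lambda>t. g y \<bullet> (t *\<^sub>R v))) (at 0)"
      using has_derivative_compose[of "\<lambda>t. y + t *\<^sub>R v" "\<lambda>t. t *\<^sub>R v" 0 UNIV \<rho> "\<lambda>v. g y \<bullet> v"] der
      by simp
    then have "((\<lambda>t. \<rho> (y + t *\<^sub>R v)) has_real_derivative g y \<bullet> v) (at 0)"
      by (rule has_derivative_imp_has_field_derivative) simp
    then obtain d where "d > 0" and d: "\<And>t. 0 < t \<Longrightarrow> t < d \<Longrightarrow> \<rho> (y + t *\<^sub>R v) < 0"
      using DERIV_neg_dec_right[of _ _ 0] v C1_defining_function_zero[OF C1 y] by force
    have "((\<lambda>t. y + t *\<^sub>R v) \<longlongrightarrow> y + 0 *\<^sub>R v) (at_right 0)"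
      by (intro tendsto_intros)
    then have "\<forall>\<^sub>F t in at_right 0. y + t *\<^sub>R v \<in> U"
      using U by (intro topological_tendstoD) auto
    moreover have "\<forall>\<^sub>F t in at_right (0::real). 0 < t \<and> t < d"
      using \<open>d > 0\<close> by (auto simp: eventually_at_right_field)
    ultimately have "\<forall>\<^sub>F t in at_right (0::real). 0 < t \<and> y + t *\<^sub>R v \<in> \<Omega>"
      by eventually_elim (use d eq in auto)
    then obtain t :: real where "0 < t" "y + t *\<^sub>R v \<in> \<Omega>"
      using eventually_happens[of _ "at_right (0::real)"] by auto
    with supp[of "y + t *\<^sub>R v"] show ?thesis by (simp add: zero_le_mult_iff)
  qed
  define a where "a = - (g y /\<^sub>R norm (g y))"
  have a: "norm a = 1" using gnz by (simp add: a_def)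
  have "a = \<nu>"
  proof (rule ccontr)
    assume "a \<noteq> \<nu>"
    then have "0 < norm (a - \<nu>) ^ 2" by simp
    also have "norm (a - \<nu>) ^ 2 = 2 - 2 * (a \<bullet> \<nu>)"
      using a unit by (simp add: power2_norm_eq_inner inner_diff inner_commute norm_eq_1)
    finally have lt: "a \<bullet> \<nu> < 1" by simp
    have "0 < a \<bullet> (a - \<nu>)" "(a - \<nu>) \<bullet> \<nu> < 0"
      using lt a unit by (simp_all add: inner_diff inner_commute norm_eq_1)
    moreover from this have "g y \<bullet> (a - \<nu>) < 0"
      using gnz by (simp add: a_def divide_simps zero_less_mult_iff mult_less_0_iff)
    ultimately show False using key by force
  qed
  with inner_unit_normal_eq[OF C1 y] show ?thesis by (simp add: a_def)
qed

lemma convex_inner_unit_normal: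
  fixes \<Omega> :: "'a::euclidean_space set"
  assumes op: "open \<Omega>" and conv: "convex \<Omega>" and smooth: "C1_smooth_at \<Omega> y"
  shows "norm (inner_unit_normal \<Omega> y) = 1"
    and "x \<in> closure \<Omega> \<Longrightarrow> 0 \<le> (x - y) \<bullet> inner_unit_normal \<Omega> y"
    and "x \<in> \<Omega> \<Longrightarrow> 0 < (x - y) \<bullet> inner_unit_normal \<Omega> y"
proof -
  have y: "y \<in> frontier \<Omega>" using smooth by (simp add: C1_smooth_at_def)
  have ri: "rel_interior \<Omega> = \<Omega>" using op by (simp add: rel_interior_open)
  obtain a where a: "a \<noteq> 0" "\<And>x. x \<in> closure \<Omega> \<Longrightarrow> a \<bullet> y \<le> a \<bullet> x"
      "\<And>x. x \<in> \<Omega> \<Longrightarrow> a \<bullet> y < a \<bullet> x"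
    using supporting_hyperplane_relative_frontier[OF conv, of y] y ri
    by (metis Diff_iff frontier_def interior_open op)
  define \<nu> where "\<nu> = a /\<^sub>R norm a"
  have n: "norm \<nu> = 1" using a by (simp add: \<nu>_def)
  have "(x - y) \<bullet> \<nu> = (a \<bullet> x - a \<bullet> y) / norm a" for x
    by (simp add: \<nu>_def inner_diff_left inner_commute divide_simps algebra_simps)
  then have le: "x \<in> closure \<Omega> \<Longrightarrow> 0 \<le> (x - y) \<bullet> \<nu>" and lt: "x \<in> \<Omega> \<Longrightarrow> 0 < (x - y) \<bullet> \<nu>" for x
    using a by auto
  have "inner_unit_normal \<Omega> y = \<nu>"
    using supporting_normal_unique[OF smooth _ n] lt by (meson less_imp_le)
  with n le lt show "norm (inner_unit_normal \<Omega> y) = 1"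
    "x \<in> closure \<Omega> \<Longrightarrow> 0 \<le> (x - y) \<bullet> inner_unit_normal \<Omega> y"
    "x \<in> \<Omega> \<Longrightarrow> 0 < (x - y) \<bullet> inner_unit_normal \<Omega> y" by auto
qed

text \<open>The ball of radius \<open>dist x y\<close> about \<open>x\<close> stays inside, so its
  lowest point in the direction of the normal is still above the supporting hyperplane at
  \<open>y\<close>. Hence the product of \<open>x - y\<close> with the normal is at least
  \<open>dist x y\<close>, the equality case of Cauchy-Schwarz.\<close>

lemma nearest_frontier_point_normal:
  fixes \<Omega> :: "'a::euclidean_space set"
  assumes op: "open \<Omega>" and conv: "convex \<Omega>" and x: "x \<in> \<Omega>"
    and y: "y \<in> frontier \<Omega>" and near: "\<And>q. q \<in> frontier \<Omega> \<Longrightarrow> dist x y \<le> dist x q"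
    and smooth: "C1_smooth_at \<Omega> y"
  shows "x = y + dist x y *\<^sub>R inner_unit_normal \<Omega> y"
proof -
  let ?n = "inner_unit_normal \<Omega> y" and ?d = "dist x y"
  have n: "norm ?n = 1" using convex_inner_unit_normal(1)[OF op conv smooth] .
  have d: "?d > 0" using x y op by (auto simp: frontier_def interior_open)
  have ball: "ball x ?d \<subseteq> \<Omega>"
  proof (rule ccontr)
    assume "\<not> ball x ?d \<subseteq> \<Omega>"
    moreover have "x \<in> ball x ?d \<inter> \<Omega>" using x d by simp
    ultimately have "ball x ?d \<inter> frontier \<Omega> \<noteq> {}"
      by (intro connected_Int_frontier[OF connected_ball]) blast+
    then obtain q where q: "q \<in> ball x ?d" "q \<in> frontier \<Omega>" by auto
    then show False using near[OF q(2)] q(1) by simp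
  qed
  then have "cball x ?d \<subseteq> closure \<Omega>"
    by (metis closure_ball closure_mono d less_irrefl)
  moreover have "x - ?d *\<^sub>R ?n \<in> cball x ?d"
    using n d by (simp add: dist_norm)
  ultimately have "0 \<le> (x - ?d *\<^sub>R ?n - y) \<bullet> ?n"
    using convex_inner_unit_normal(2)[OF op conv smooth] by blast
  then have "?d \<le> (x - y) \<bullet> ?n"
    using n by (simp add: inner_diff_left norm_eq_1)
  moreover have "norm ((x - y) - ?d *\<^sub>R ?n) ^ 2 = 2 * ?d * (?d - (x - y) \<bullet> ?n)"
  proof -
    have nn: "?n \<bullet> ?n = 1" using n by (simp add: norm_eq_1)
    have "(x - y) \<bullet> (x - y) = ?d * ?d" by (simp add: dist_norm flip: power2_eq_square power2_norm_eq_inner)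
    then have "((x - y) - ?d *\<^sub>R ?n) \<bullet> ((x - y) - ?d *\<^sub>R ?n) = 2 * ?d * (?d - (x - y) \<bullet> ?n)"
      using nn by (simp only: inner_diff_left[of "x - y"] inner_diff_right[of _ "x - y"] inner_scaleR_left
          inner_scaleR_right inner_commute[of ?n "x - y"]) (simp add: algebra_simps)
    then show ?thesis by (simp only: power2_norm_eq_inner)
  qed
  ultimately have "norm ((x - y) - ?d *\<^sub>R ?n) ^ 2 \<le> 0"
    using d by (simp add: mult_nonneg_nonpos)
  then show ?thesis by (simp add: algebra_simps)
qed

text \<open>The witness is the point of the closure nearest to \<open>x\<close>: its supporting
  hyperplane has \<open>p\<close> on the inner and \<open>x\<close> on the outer side, and the
  triangle inequality through \<open>x\<close> gives the factor 2. Used contrapositively: a point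
  belongs to the domain if its displacement from \<open>p\<close> has positive product with all
  nearby normals.\<close>

lemma exterior_point_normal:
  fixes \<Omega> :: "'a::euclidean_space set"
  assumes op: "open \<Omega>" and conv: "convex \<Omega>" and x: "x \<notin> \<Omega>" and p: "p \<in> frontier \<Omega>"
    and smooth: "\<And>y. y \<in> frontier \<Omega> \<Longrightarrow> dist p y \<le> 2 * dist x p \<Longrightarrow> C1_smooth_at \<Omega> y"
  obtains y where "y \<in> frontier \<Omega>" "dist p y \<le> 2 * dist x p"
    "(x - p) \<bullet> inner_unit_normal \<Omega> y \<le> 0"
proof -
  have pc: "p \<in> closure \<Omega>" using p by (simp add: frontier_def)
  obtain y where y: "y \<in> closure \<Omega>" and near: "\<And>q. q \<in> closure \<Omega> \<Longrightarrow> dist x y \<le> dist x q"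
    by (rule distance_attains_inf[OF closed_closure, of \<Omega> x]) (use pc in auto)
  have yf: "y \<in> frontier \<Omega>"
  proof (cases "x \<in> closure \<Omega>")
    case True
    then have "x = y" using near[of x] by simp
    then show ?thesis using x y op by (simp add: frontier_def interior_open)
  next
    case False
    show ?thesis
    proof (rule ccontr)
      assume "y \<notin> frontier \<Omega>"
      then have "y \<in> \<Omega>" using y op by (simp add: frontier_def interior_open)
      then obtain q where "q \<in> open_segment x y" "q \<in> frontier \<Omega>"
      proof -
        have "closed_segment x y \<inter> frontier \<Omega> \<noteq> {}"
          using \<open>y \<in> \<Omega>\<close> x by (intro connected_Int_frontier) auto
        moreover have "x \<notin> frontier \<Omega>" using False by (auto simp: frontier_def)
        ultimately show ?thesis
          using that \<open>y \<notin> frontier \<Omega>\<close> by (auto simp: open_segment_def)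
      qed
      then show False
        using near[of q] dist_in_open_segment[of q x y] by (auto simp: frontier_def dist_commute)
    qed
  qed
  have dist: "dist p y \<le> 2 * dist x p"
    using dist_triangle[of p y x] near[OF pc] by (simp add: dist_commute)
  let ?n = "inner_unit_normal \<Omega> y"
  note sm = smooth[OF yf dist]
  have "(x - y) \<bullet> ?n \<le> 0"
  proof (cases "x = y")
    case False
    define \<nu> where "\<nu> = (y - x) /\<^sub>R norm (y - x)"
    have "0 \<le> (q - y) \<bullet> \<nu>" if "q \<in> \<Omega>" for q
    proof -
      have "(x - y) \<bullet> (q - y) \<le> 0"
        using any_closest_point_dot[OF convex_closure[OF conv] closed_closure y, of q x] near that closure_subset by blast
      then show ?thesis
        using False by (simp add: \<nu>_def inner_diff inner_commute zero_le_mult_iff)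
    qed
    then have n: "?n = \<nu>"
      using False by (intro supporting_normal_unique[OF sm]) (auto simp: \<nu>_def)
    have "(x - y) \<bullet> \<nu> = - ((y - x) \<bullet> \<nu>)" by (simp add: inner_diff_left)
    moreover have "0 \<le> (y - x) \<bullet> \<nu>" by (simp add: \<nu>_def)
    ultimately show ?thesis unfolding n by linarith
  qed simp
  moreover have "0 \<le> (p - y) \<bullet> ?n"
    using convex_inner_unit_normal(2)[OF op conv sm pc] .
  ultimately have "(x - p) \<bullet> ?n \<le> 0" by (simp add: inner_diff_left)
  with yf dist show thesis by (rule that)
qed

section \<open>The Hermitian product\<close>

text \<open>Complex-linear in the first argument, with the Euclidean product as real part. So for
  the inner normal \<open>n\<close> at \<open>q\<close>, \<open>herm (x - q) n\<close> is a
  holomorphic function of \<open>x\<close> that maps a convex domain into the right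
  half-plane.\<close>

definition herm :: "complex ^ 'n \<Rightarrow> complex ^ 'n \<Rightarrow> complex" where
  "herm v w = (\<Sum>i\<in>UNIV. v $ i * cnj (w $ i))"

lemma Re_herm: "Re (herm v w) = v \<bullet> w"
  by (simp add: herm_def inner_vec_def inner_complex_def)

lemma herm_smult_left: "herm (c *s v) w = c * herm v w"
  by (simp add: herm_def sum_distrib_left mult_ac)

lemma herm_diff_left: "herm (u - v) w = herm u w - herm v w"
  by (simp add: herm_def algebra_simps sum_subtractf)

lemma herm_diff_right: "herm w (u - v) = herm w u - herm w v"
  by (simp add: herm_def algebra_simps sum_subtractf)

lemma norm_smult_complex: "norm (c *s v) = norm c * norm (v :: complex ^ 'n)"
  by (simp add: norm_vec_def norm_mult L2_set_right_distrib)

lemma herm_self: "herm v v = of_real ((norm v)\<^sup>2)"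
proof -
  have "Im (herm v v) = 0" by (simp add: herm_def mult.commute)
  moreover have "Re (herm v v) = (norm v)\<^sup>2" by (simp add: Re_herm power2_norm_eq_inner)
  ultimately show ?thesis by (simp add: complex_eq_iff)
qed

text \<open>Rotating \<open>v\<close> by the phase \<open>c\<close> makes the product real, which
  reduces the claim to the real Cauchy-Schwarz inequality.\<close>

lemma norm_herm_le: "norm (herm v w) \<le> norm v * norm w"
proof (cases "herm v w = 0")
  case False
  define c where "c = cnj (herm v w) / norm (herm v w)"
  have c: "norm c = 1" using False by (simp add: c_def norm_divide)
  have "c * herm v w = norm (herm v w)"
    using False by (simp add: c_def complex_norm_square[symmetric] field_simps power2_eq_square)
  then have "norm (herm v w) = Re (herm (c *s v) w)"
    by (simp add: herm_smult_left)
  also have "\<dots> \<le> norm (c *s v) * norm w"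
    by (simp add: Re_herm norm_cauchy_schwarz)
  finally show ?thesis by (simp add: norm_smult_complex c)
qed simp

lemma smult_complex_inner: "(c *s v) \<bullet> v = Re c * (norm v)\<^sup>2"
  for v :: "complex ^ 'n"
  by (simp flip: Re_herm add: herm_smult_left herm_self)

lemma scaleR_eq_smult: "r *\<^sub>R v = of_real r *s (v :: complex ^ 'n)"
  unfolding vec_eq_iff vector_smult_component vector_scaleR_component by (simp add: scaleR_conv_of_real)

text \<open>The real part tests \<open>v\<close> and the imaginary part tests
  \<open>- \<i> *s v\<close> against the normal. This turns strict convexity in the complex sense
  into non-vanishing of a holomorphic functional.\<close>

lemma herm_eq_0_iff:
  "herm v (inner_unit_normal \<Omega> p) = 0 \<longleftrightarrow> v \<in> complex_tangent_space \<Omega> p"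
proof -
  let ?n = "inner_unit_normal \<Omega> p"
  have i: "\<i> *s (- \<i> *s v) = v" by (simp add: vec_eq_iff)
  have "Re (herm (- \<i> *s v) ?n) = Im (herm v ?n)"
    by (simp only: herm_smult_left) simp
  then have "(- \<i> *s v) \<bullet> ?n = 0 \<longleftrightarrow> Im (herm v ?n) = 0" by (simp add: Re_herm)
  moreover have "v \<in> (\<lambda>v. \<i> *s v) ` real_tangent_space \<Omega> p \<longleftrightarrow> - \<i> *s v \<in> real_tangent_space \<Omega> p"
  proof
    assume "v \<in> (\<lambda>v. \<i> *s v) ` real_tangent_space \<Omega> p"
    then obtain u where u: "v = \<i> *s u" "u \<in> real_tangent_space \<Omega> p" by auto
    have "- \<i> *s v = u" unfolding u(1) by (simp add: vec_eq_iff)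
    with u(2) show "- \<i> *s v \<in> real_tangent_space \<Omega> p" by simp
  next
    assume "- \<i> *s v \<in> real_tangent_space \<Omega> p"
    then show "v \<in> (\<lambda>v. \<i> *s v) ` real_tangent_space \<Omega> p" using i by (metis image_eqI)
  qed
  ultimately show ?thesis
    by (simp add: complex_tangent_space_def real_tangent_space_def complex_eq_iff Re_herm inner_commute)
qed

section \<open>Upper bounds for the Kobayashi distance by chains of affine discs\<close>

text \<open>An inductive form of the chains in \<open>kobayashi_dist\<close>, so that chains are
  joined without index bookkeeping. There is no empty chain, in accordance with
  \<open>m > 0\<close>; the indexed form is recovered once, in
  \<open>disc_chain_sequence\<close>.\<close>

inductive disc_chain :: "(complex ^ 'n) set \<Rightarrow> complex ^ 'n \<Rightarrow> complex ^ 'n \<Rightarrow> real \<Rightarrow> bool"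
  for \<Omega> where
  disc: "holomorphic_disc \<Omega> \<phi> \<Longrightarrow> a \<in> ball 0 1 \<Longrightarrow> b \<in> ball 0 1 \<Longrightarrow>
    disc_chain \<Omega> (\<phi> a) (\<phi> b) (poincare_dist a b)"
| snoc: "disc_chain \<Omega> x (\<phi> a) L \<Longrightarrow> holomorphic_disc \<Omega> \<phi> \<Longrightarrow> a \<in> ball 0 1 \<Longrightarrow> b \<in> ball 0 1 \<Longrightarrow>
    disc_chain \<Omega> x (\<phi> b) (L + poincare_dist a b)"

lemma disc_chain_trans:
  assumes "disc_chain \<Omega> y z M" "disc_chain \<Omega> x y L"
  shows "disc_chain \<Omega> x z (L + M)"
  using assms
proof (induction arbitrary: L rule: disc_chain.induct)
  case (disc \<phi> a b)
  then show ?case by (intro disc_chain.snoc)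
next
  case (snoc y \<phi> a M b)
  then have "disc_chain \<Omega> x (\<phi> a) (L + M)" by blast
  from disc_chain.snoc[OF this snoc.hyps(2-4)] show ?case by (simp add: add.assoc)
qed

lemma disc_chain_sym: "disc_chain \<Omega> x y L \<Longrightarrow> \<exists>M. disc_chain \<Omega> y x M"
proof (induction rule: disc_chain.induct)
  case (disc \<phi> a b)
  then show ?case using disc_chain.disc by blast
next
  case (snoc x \<phi> a L b)
  then show ?case using disc_chain.disc[OF snoc.hyps(2,4,3)] disc_chain_trans by blast
qed

lemma disc_chain_sequence:
  assumes "disc_chain \<Omega> x y L"
  shows "\<exists>m p \<phi> a b. L = (\<Sum>j<m. poincare_dist (a j) (b j)) \<and> m > 0 \<and> p 0 = x \<and> p m = y \<and>
            (\<forall>j<m. holomorphic_disc \<Omega> (\<phi> j) \<and> a j \<in> ball 0 1 \<and> b j \<in> ball 0 1 \<and>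
                   \<phi> j (a j) = p j \<and> \<phi> j (b j) = p (Suc j))"
  using assms
proof (induction rule: disc_chain.induct)
  case (disc \<phi> a b)
  then show ?case
    by (intro exI[of _ "1::nat"] exI[of _ "\<lambda>j. if j = 0 then \<phi> a else \<phi> b"]
        exI[of _ "\<lambda>_. \<phi>"] exI[of _ "\<lambda>_. a"] exI[of _ "\<lambda>_. b"]) auto
next
  case (snoc x \<psi> u L v)
  then obtain m p \<phi> a b where *: "L = (\<Sum>j<m. poincare_dist (a j) (b j))" "m > 0" "p 0 = x" "p m = \<psi> u"
    "\<And>j. j < m \<Longrightarrow> holomorphic_disc \<Omega> (\<phi> j) \<and> a j \<in> ball 0 1 \<and> b j \<in> ball 0 1 \<and>
                   \<phi> j (a j) = p j \<and> \<phi> j (b j) = p (Suc j)" by blast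
  have "L + poincare_dist u v = (\<Sum>j<Suc m. poincare_dist ((a(m := u)) j) ((b(m := v)) j))"
    using *(1) by simp
  then show ?case using * snoc.hyps
    by (intro exI[of _ "Suc m"] exI[of _ "p(Suc m := \<psi> v)"]
        exI[of _ "\<phi>(m := \<psi>)"] exI[of _ "a(m := u)"] exI[of _ "b(m := v)"])
      (auto simp: less_Suc_eq)
qed

lemma kobayashi_dist_le_disc_chain:
  assumes "disc_chain \<Omega> x y L"
  shows "kobayashi_dist \<Omega> x y \<le> L"
  unfolding kobayashi_dist_def
proof (rule cInf_lower)
  show "L \<in> {(\<Sum>j<m. poincare_dist (a j) (b j)) | m p \<phi> a b.
            m > 0 \<and> p 0 = x \<and> p m = y \<and>
            (\<forall>j<m. holomorphic_disc \<Omega> (\<phi> j) \<and> a j \<in> ball 0 1 \<and> b j \<in> ball 0 1 \<and>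
                   \<phi> j (a j) = p j \<and> \<phi> j (b j) = p (Suc j))}"
    using disc_chain_sequence[OF assms] by simp
  show "bdd_below {(\<Sum>j<m. poincare_dist (a j) (b j)) | m p \<phi> a b.
            m > 0 \<and> p 0 = x \<and> p m = y \<and>
            (\<forall>j<m. holomorphic_disc \<Omega> (\<phi> j) \<and> a j \<in> ball 0 1 \<and> b j \<in> ball 0 1 \<and>
                   \<phi> j (a j) = p j \<and> \<phi> j (b j) = p (Suc j))}"
    by (rule bdd_belowI[of _ 0]) (auto intro!: sum_nonneg poincare_dist_nonneg)
qed

lemma affine_holomorphic_disc:
  assumes "\<And>\<zeta>. norm \<zeta> < 1 \<Longrightarrow> c + \<zeta> *s v \<in> \<Omega>"
  shows "holomorphic_disc \<Omega> (\<lambda>\<zeta>. c + \<zeta> *s v)"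
  unfolding holomorphic_disc_def image_subset_iff
proof safe
  show "(\<lambda>\<zeta>. (c + \<zeta> *s v) $ i) holomorphic_on ball 0 1" for i
    unfolding vector_add_component vector_smult_component by (intro holomorphic_intros)
  show "c + \<zeta> *s v \<in> \<Omega>" if "\<zeta> \<in> ball 0 1" for \<zeta>
    using assms[of \<zeta>] that by simp
qed

lemma disc_chain_ball:
  assumes "ball x r \<subseteq> \<Omega>" "dist x y < r / 2"
  shows "disc_chain \<Omega> x y (artanh (1/2))"
proof -
  let ?\<phi> = "\<lambda>\<zeta>. x + \<zeta> *s (2 *s (y - x))"
  have "holomorphic_disc \<Omega> ?\<phi>"
  proof (rule affine_holomorphic_disc)
    fix \<zeta> :: complex assume "norm \<zeta> < 1"
    then have "norm \<zeta> * (2 * norm (y - x)) \<le> 1 * (2 * norm (y - x))"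
      by (intro mult_right_mono) auto
    also have "\<dots> < r" using assms(2) by (simp add: dist_norm norm_minus_commute)
    finally have "norm (\<zeta> *s (2 *s (y - x))) < r"
      unfolding norm_smult_complex by simp
    then show "x + \<zeta> *s (2 *s (y - x)) \<in> \<Omega>"
      by (intro subsetD[OF assms(1)]) (simp add: dist_norm norm_minus_commute)
  qed
  moreover have "?\<phi> 0 = x" "?\<phi> (1/2) = y" by (simp_all add: vec_eq_iff)
  moreover have "poincare_dist 0 (1/2) = artanh (1/2)" by (simp add: poincare_dist_def norm_divide)
  ultimately show ?thesis
    using disc_chain.disc[of \<Omega> ?\<phi> 0 "1/2"] by simp
qed

text \<open>Every point has a ball reached from it at the fixed cost \<open>artanh (1/2)\<close>.
  Connectedness then gives some chain from \<open>c\<close> to each point, and a finite subcover of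
  \<open>K\<close> makes the length uniform.\<close>

lemma disc_chain_compact_bound:
  assumes op: "open \<Omega>" and conn: "connected \<Omega>" and c: "c \<in> \<Omega>"
    and K: "compact K" "K \<subseteq> \<Omega>"
  obtains M where "\<And>x. x \<in> K \<Longrightarrow> \<exists>L\<le>M. disc_chain \<Omega> c x L"
proof -
  have loc: "\<exists>r>0. \<forall>y\<in>ball x r. disc_chain \<Omega> x y (artanh (1/2))" if x: "x \<in> \<Omega>" for x
  proof -
    obtain r where "r > 0" "ball x r \<subseteq> \<Omega>" using op x openE by blast
    then show ?thesis by (intro exI[of _ "r/2"]) (auto intro: disc_chain_ball)
  qed
  have ex: "\<exists>L. disc_chain \<Omega> c x L" if x: "x \<in> \<Omega>" for x
  proof (rule connected_equivalence_relation[OF conn c x])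
    fix x assume x: "x \<in> \<Omega>"
    then obtain r where "r > 0" "\<forall>y\<in>ball x r. disc_chain \<Omega> x y (artanh (1/2))" using loc by blast
    then show "\<exists>T. openin (top_of_set \<Omega>) T \<and> x \<in> T \<and> (\<forall>y\<in>T. \<exists>L. disc_chain \<Omega> x y L)"
      using x by (intro exI[of _ "\<Omega> \<inter> ball x r"]) (auto intro: openin_open_Int)
  qed (blast intro: disc_chain_sym disc_chain_trans)+
  have "\<exists>r M. r > 0 \<and> (\<forall>y\<in>ball x r. disc_chain \<Omega> c y M)" if x: "x \<in> K" for x
    using ex[of x] loc[of x] x K by (meson disc_chain_trans subsetD)
  then obtain r M where r: "\<And>x. x \<in> K \<Longrightarrow> r x > 0"
    and M: "\<And>x y. x \<in> K \<Longrightarrow> y \<in> ball x (r x) \<Longrightarrow> disc_chain \<Omega> c y (M x)" by metis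
  obtain C where C: "C \<subseteq> K" "finite C" "K \<subseteq> (\<Union>x\<in>C. ball x (r x))"
  proof (rule compactE_image[OF K(1), of K "\<lambda>x. ball x (r x)"])
    show "K \<subseteq> (\<Union>x\<in>K. ball x (r x))" using r by force
  qed auto
  show ?thesis
  proof (rule that)
    fix y assume "y \<in> K"
    then obtain x where x: "x \<in> C" "y \<in> ball x (r x)" using C by blast
    have "M x \<le> Max (M ` C)" using x C by simp
    with M[of x y] x C show "\<exists>L\<le>Max (M ` C). disc_chain \<Omega> c y L" by blast
  qed
qed

section \<open>Poincare lengths on the real axis and along a normal\<close>

lemma exp_two_artanh:
  assumes "0 \<le> u" "u < (1::real)"
  shows "exp (2 * artanh u) = (1 + u) / (1 - u)"
  using assms by (simp add: artanh_def)

lemma artanh_le_imp: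
  assumes "0 \<le> u" "u < (1::real)" "artanh u \<le> L"
  shows "1 / (1 - u) \<le> exp (2 * L)"
proof -
  have "1 / (1 - u) \<le> (1 + u) / (1 - u)" using assms by (simp add: divide_right_mono)
  also have "\<dots> \<le> exp (2 * L)" using exp_two_artanh[OF assms(1,2)] assms(3)
    by (metis exp_le_cancel_iff mult_le_cancel_left_pos zero_less_numeral)
  finally show ?thesis .
qed

text \<open>The split isolates the end \<open>-1\<close>, which will correspond to the boundary
  point and carries the logarithm of the ratio of depths, from the far end \<open>1\<close>, which
  contributes only an error.\<close>

lemma poincare_dist_real:
  assumes "-1 < a" "a \<le> b" "b < (1::real)"
  shows "poincare_dist (of_real b) (of_real a) = ln ((1 + b) / (1 + a)) / 2 + ln ((1 - a) / (1 - b)) / 2"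
proof -
  have "\<bar>a\<bar> < 1" "\<bar>b\<bar> < 1" using assms by linarith+
  then have "\<bar>a * b\<bar> < 1" using abs_mult_less[of a 1 b 1] by (simp add: abs_mult)
  then have ab: "a * b < 1" by linarith
  have "(complex_of_real b - of_real a) / (1 - cnj (of_real a) * of_real b) = of_real ((b - a) / (1 - a * b))"
    by simp
  then have "norm ((complex_of_real b - of_real a) / (1 - cnj (of_real a) * of_real b)) = (b - a) / (1 - a * b)"
    using assms ab by (simp only: norm_of_real) simp
  moreover have "(1 + (b - a) / (1 - a * b)) = (1 + b) * (1 - a) / (1 - a * b)"
    "(1 - (b - a) / (1 - a * b)) = (1 + a) * (1 - b) / (1 - a * b)"
    using ab by (simp_all add: field_simps)
  ultimately have "poincare_dist (of_real b) (of_real a) =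
      ln (((1 + b) * (1 - a) / (1 - a * b)) / ((1 + a) * (1 - b) / (1 - a * b))) / 2"
    unfolding poincare_dist_def artanh_def by simp
  also have "((1 + b) * (1 - a) / (1 - a * b)) / ((1 + a) * (1 - b) / (1 - a * b))
      = ((1 + b) / (1 + a)) * ((1 - a) / (1 - b))"
  proof -
    have "(x / d) / (y / d) = x / y" if "d \<noteq> 0" for x y d :: real using that by simp
    then show ?thesis using ab by (simp add: mult.commute)
  qed
  also have "ln \<dots> = ln ((1 + b) / (1 + a)) + ln ((1 - a) / (1 - b))"
    using assms by (intro ln_mult_pos) auto
  finally show ?thesis by (simp add: add_divide_distrib)
qed

text \<open>Here \<open>ln (t / s) / 2\<close> is the half-plane distance between the depths \<open>t\<close> and \<open>s\<close>; the error
  \<open>\<tau> / s\<close> is due to the gap between disc and boundary, \<open>t / R\<close> to the curvature of the disc.\<close>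

lemma disc_chain_normal_step:
  fixes p v :: "complex ^ 'n"
  assumes disc: "\<And>\<zeta>. norm (\<zeta> - of_real R) < R - \<tau> \<Longrightarrow> p + \<zeta> *s v \<in> \<Omega>"
    and s: "0 < s" "s \<le> t" and \<tau>: "0 \<le> \<tau>" "\<tau> \<le> s / 2" and t: "t \<le> R / 2"
  shows "\<exists>L \<le> ln (t / s) / 2 + \<tau> / s + t / R. disc_chain \<Omega> (p + t *\<^sub>R v) (p + s *\<^sub>R v) L"
proof -
  have pos: "0 < R" "0 < R - \<tau>" "0 < s - \<tau>" "0 < t - \<tau>" using assms by auto
  let ?\<phi> = "\<lambda>\<zeta>. (p + of_real R *s v) + \<zeta> *s (of_real (R - \<tau>) *s v)"
  have \<phi>: "?\<phi> \<zeta> = p + (of_real R + \<zeta> * of_real (R - \<tau>)) *s v" for \<zeta>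
    by (simp add: vec_eq_iff algebra_simps)
  have hd: "holomorphic_disc \<Omega> ?\<phi>"
  proof (rule affine_holomorphic_disc)
    fix \<zeta> :: complex assume "norm \<zeta> < 1"
    then have "norm \<zeta> * (R - \<tau>) < 1 * (R - \<tau>)" using pos by (intro mult_strict_right_mono) auto
    then show "?\<phi> \<zeta> \<in> \<Omega>" unfolding \<phi> using pos
      by (intro disc) (simp add: norm_mult flip: of_real_diff)
  qed
  \<comment> \<open>The parameter in the unit disc of the point at depth \<open>r\<close> on the
    normal; depth \<open>\<tau>\<close> corresponds to \<open>-1\<close>.\<close>
  define coord where "coord r = (r - R) / (R - \<tau>)" for r
  have \<phi>c: "?\<phi> (of_real (coord r)) = p + r *\<^sub>R v" for r
  proof -
    have "complex_of_real R + of_real (coord r) * of_real (R - \<tau>) = of_real (R + coord r * (R - \<tau>))"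
      by simp
    also have "R + coord r * (R - \<tau>) = r" using pos by (simp add: coord_def)
    finally show ?thesis unfolding \<phi> by (simp add: scaleR_eq_smult)
  qed
  have "coord s \<le> coord t"
    unfolding coord_def using s pos by (intro divide_right_mono) auto
  then have sb: "-1 < coord s" "coord s \<le> coord t" "coord t < 1"
    using pos s t \<tau> by (simp_all add: coord_def divide_simps)
  have "disc_chain \<Omega> (?\<phi> (of_real (coord t))) (?\<phi> (of_real (coord s)))
      (poincare_dist (of_real (coord t)) (of_real (coord s)))"
    using sb by (intro disc_chain.disc hd) auto
  moreover have "poincare_dist (of_real (coord t)) (of_real (coord s)) \<le> ln (t / s) / 2 + \<tau> / s + t / R"
  proof -
    have ln_bound: "ln (1 / (1 - x)) \<le> 2 * x" if "0 \<le> x" "x \<le> 1/2" for x :: real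
      using ln_one_minus_pos_lower_bound[of x] that mult_left_mono[of x "1/2" x]
      by (simp add: ln_div power2_eq_square)
    have c: "1 + coord r = (r - \<tau>) / (R - \<tau>)" "1 - coord r = (2 * R - \<tau> - r) / (R - \<tau>)" for r
      using pos by (simp_all add: coord_def field_simps)
    have e1: "(1 + coord t) / (1 + coord s) = (t - \<tau>) / (s - \<tau>)"
      and e2: "(1 - coord s) / (1 - coord t) = (2 * R - \<tau> - s) / (2 * R - \<tau> - t)"
      unfolding c using pos by simp_all
    have "(t - \<tau>) / (s - \<tau>) \<le> t / (s - \<tau>)"
      using pos \<tau> by (intro divide_right_mono) auto
    also have "\<dots> = (t / s) * (1 / (1 - \<tau> / s))" using s pos by (simp add: field_simps)
    finally have "ln ((t - \<tau>) / (s - \<tau>)) \<le> ln ((t / s) * (1 / (1 - \<tau> / s)))"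
      using pos s \<tau> by (subst ln_le_cancel_iff) (auto simp: field_simps intro!: mult_pos_pos)
    also have "\<dots> = ln (t / s) + ln (1 / (1 - \<tau> / s))"
      using pos s \<tau> by (intro ln_mult_pos) (auto simp: field_simps)
    also have "ln (1 / (1 - \<tau> / s)) \<le> 2 * (\<tau> / s)"
      using s \<tau> by (intro ln_bound) (auto simp: field_simps)
    finally have b1: "ln ((t - \<tau>) / (s - \<tau>)) \<le> ln (t / s) + 2 * (\<tau> / s)" by simp
    have "(2 * R - \<tau> - s) / (2 * R - \<tau> - t) \<le> 1 / (1 - t / R)"
    proof -
      have "(2 * R - \<tau> - s) * (R - t) \<le> R * (2 * R - \<tau> - t)"
      proof -
        have "R * (2 * R - \<tau> - t) - (2 * R - \<tau> - s) * (R - t) = t * (R - \<tau>) + s * (R - t)"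
          by (simp add: algebra_simps)
        moreover have "0 \<le> t * (R - \<tau>) + s * (R - t)" using pos s t by (intro add_nonneg_nonneg) auto
        ultimately show ?thesis by linarith
      qed
      moreover have "1 / (1 - t / R) = R / (R - t)" using pos by (simp add: field_simps)
      ultimately show ?thesis using pos s t \<tau> by (simp add: divide_simps mult.commute)
    qed
    then have "ln ((2 * R - \<tau> - s) / (2 * R - \<tau> - t)) \<le> ln (1 / (1 - t / R))"
      using pos s t \<tau> by (subst ln_le_cancel_iff) (auto simp: field_simps)
    also have "\<dots> \<le> 2 * (t / R)"
      using s t pos by (intro ln_bound) (auto simp: field_simps)
    finally have b2: "ln ((2 * R - \<tau> - s) / (2 * R - \<tau> - t)) \<le> 2 * (t / R)" .
    show ?thesis
      unfolding poincare_dist_real[OF sb] e1 e2 using b1 b2 by linarith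
  qed
  ultimately show ?thesis unfolding \<phi>c by blast
qed

section \<open>The boundary estimate at Dini-smooth points\<close>

lemma normal_modulus_mono: "s \<le> t \<Longrightarrow> normal_modulus \<Omega> U s \<le> normal_modulus \<Omega> U t"
  unfolding normal_modulus_def by (rule Sup_subset_mono) fastforce

text \<open>Comparison of integral and series on dyadic intervals. Finiteness of the modulus matters
  because \<open>enn2real\<close> sends infinity to 0.\<close>

lemma Dini_normal_modulus_summable:
  assumes fin: "(\<integral>\<^sup>+t\<in>{0<..<1}. (normal_modulus \<Omega> U t / ennreal t) \<partial>lborel) < \<infinity>"
    and bdd: "\<And>t. normal_modulus \<Omega> U t < \<infinity>"
  shows "summable (\<lambda>j. enn2real (normal_modulus \<Omega> U ((1/2) ^ j)))"
proof -
  define N where "N = normal_modulus \<Omega> U"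
  define W where "W j = enn2real (N ((1/2) ^ j))" for j
  define I :: "nat \<Rightarrow> real set" where "I j = {(1/2) ^ Suc j..<(1/2) ^ j}" for j
  \<comment> \<open>Lower bound for the integrand on \<open>I j\<close>: the modulus is at least its
    value at the left end, and \<open>1 / t\<close> is at least \<open>2 ^ j\<close>. As
    \<open>I j\<close> has length \<open>(1/2) ^ j / 2\<close>, it contributes
    \<open>W (Suc j) / 2\<close>.\<close>
  define c where "c j = ennreal (W (Suc j) * 2 ^ j)" for j
  have NW: "N ((1/2) ^ j) = ennreal (W j)" for j
    using bdd[of "(1/2) ^ j"] by (simp add: W_def N_def)
  have W0: "0 \<le> W j" for j by (simp add: W_def)
  have uniq: "j = k" if "t \<in> I j" "t \<in> I k" for j k t
  proof -
    have False if "a < b" "t \<in> I a" "t \<in> I b" for a b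
    proof -
      have "(1/2 :: real) ^ b \<le> (1/2) ^ Suc a" using \<open>a < b\<close> by (intro power_decreasing) auto
      then show False using that by (auto simp: I_def)
    qed
    then show ?thesis using that by (metis linorder_neqE_nat)
  qed
  \<comment> \<open>Finite step functions lie below the integrand pointwise, and
    \<open>nn_integral_mono\<close> asks for no measurability of the modulus.\<close>
  have pt: "(\<Sum>j<n. c j * indicator (I j) t) \<le> N t / ennreal t * indicator {0<..<1} t" for n t
  proof (cases "\<exists>k<n. t \<in> I k")
    case True
    then obtain k where k: "k < n" "t \<in> I k" by blast
    have "(\<Sum>j<n. c j * indicator (I j) t) = (\<Sum>j<n. if j = k then c k else 0)"
      using uniq k by (intro sum.cong) (auto simp: indicator_def)
    also have "\<dots> = c k" using k by simp
    also have "c k \<le> N t / ennreal t * indicator {0<..<1} t"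
    proof -
      have t: "(1/2) ^ Suc k \<le> t" "t < (1/2) ^ k" using k by (auto simp: I_def)
      have "0 < (1/2::real) ^ Suc k" by (rule zero_less_power) simp
      then have t0: "0 < t" using t by linarith
      have "(1/2::real) ^ k \<le> 1" by (rule power_le_one) auto
      then have t1: "t < 1" using t by linarith
      have "2 ^ k \<le> 1 / t"
        using t t0 by (simp add: field_simps power_one_over)
      then have "c k \<le> ennreal (W (Suc k) * (1 / t))"
        unfolding c_def by (intro ennreal_leI mult_left_mono W0)
      also have "\<dots> = N ((1/2) ^ Suc k) / ennreal t"
        using W0 t0 by (simp only: NW divide_ennreal) simp
      also have "\<dots> \<le> N t / ennreal t"
        unfolding N_def by (intro divide_right_mono_ennreal normal_modulus_mono t)
      finally show ?thesis using t0 t1 by simp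
    qed
    finally show ?thesis .
  next
    case False
    then have "(\<Sum>j<n. c j * indicator (I j) t) = 0" by (intro sum.neutral) auto
    then show ?thesis by simp
  qed
  define B where "B = (\<integral>\<^sup>+t\<in>{0<..<1}. (N t / ennreal t) \<partial>lborel)"
  have B: "B < \<infinity>" using fin by (simp add: B_def N_def)
  have "(\<Sum>j<n. W (Suc j) / 2) \<le> enn2real B" for n
  proof -
    have int: "(\<integral>\<^sup>+t. c j * indicator (I j) t \<partial>lborel) = ennreal (W (Suc j) / 2)" for j
    proof -
      have "(\<integral>\<^sup>+t. c j * indicator (I j) t \<partial>lborel) = c j * emeasure lborel (I j)"
        by (intro nn_integral_cmult_indicator) (simp add: I_def)
      also have "emeasure lborel (I j) = ennreal ((1/2) ^ j / 2)"
        by (simp add: I_def)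
      also have "c j * ennreal ((1/2) ^ j / 2) = ennreal (W (Suc j) * 2 ^ j * ((1/2) ^ j / 2))"
        using W0 unfolding c_def by (intro ennreal_mult[symmetric]) auto
      also have "W (Suc j) * 2 ^ j * ((1/2) ^ j / 2) = W (Suc j) / 2"
        by (simp add: power_one_over)
      finally show ?thesis .
    qed
    have "ennreal (\<Sum>j<n. W (Suc j) / 2) = (\<Sum>j<n. ennreal (W (Suc j) / 2))"
      using W0 by (intro sum_ennreal[symmetric]) simp
    also have "\<dots> = (\<integral>\<^sup>+t. (\<Sum>j<n. c j * indicator (I j) t) \<partial>lborel)"
    proof -
      have "(\<lambda>t. c j * indicator (I j) t) \<in> borel_measurable lborel" for j
        by (simp add: I_def)
      then show ?thesis by (subst nn_integral_sum) (simp_all add: int)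
    qed
    also have "\<dots> \<le> B"
      unfolding B_def by (intro nn_integral_mono pt)
    finally show ?thesis
      using B W0 by (metis ennreal_enn2real_if ennreal_le_iff enn2real_nonneg infinity_ennreal_def less_irrefl)
  qed
  then have "summable (\<lambda>j. W (Suc j) / 2)"
    using W0 by (intro summableI_nonneg_bounded) auto
  then have "summable (\<lambda>j. W (Suc j) / 2 * 2)" by (rule summable_mult2)
  then have "summable (\<lambda>j. W (Suc j))" by simp
  then show ?thesis
    unfolding W_def N_def by (subst (asm) summable_Suc_iff)
qed

text \<open>Unit normals differ by at most 2, so the modulus is finite and its real version loses
  nothing.\<close>

lemma C1_Dini_normal_modulus:
  fixes \<Omega> :: "'a::euclidean_space set"
  assumes op: "open \<Omega>" and conv: "convex \<Omega>" and Dini: "C1_Dini_smooth_at \<Omega> p"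
  obtains r and W :: "nat \<Rightarrow> real" where "r > 0" "summable W" "decseq W" "\<And>j. 0 \<le> W j"
    "\<And>y. y \<in> frontier \<Omega> \<Longrightarrow> dist p y < r \<Longrightarrow> C1_smooth_at \<Omega> y"
    "\<And>j x y. x \<in> frontier \<Omega> \<Longrightarrow> y \<in> frontier \<Omega> \<Longrightarrow> dist p x < r \<Longrightarrow> dist p y < r \<Longrightarrow>
       dist x y < (1/2) ^ j \<Longrightarrow> norm (inner_unit_normal \<Omega> x - inner_unit_normal \<Omega> y) \<le> W j"
proof -
  obtain U where U: "open U" "p \<in> U" "\<And>y. y \<in> frontier \<Omega> \<inter> U \<Longrightarrow> C1_smooth_at \<Omega> y"
    and fin: "(\<integral>\<^sup>+t\<in>{0<..<1}. (normal_modulus \<Omega> U t / ennreal t) \<partial>lborel) < \<infinity>"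
    using Dini unfolding C1_Dini_smooth_at_def by blast
  obtain r where r: "r > 0" "ball p r \<subseteq> U" using U openE by blast
  let ?W = "\<lambda>j::nat. enn2real (normal_modulus \<Omega> U ((1/2) ^ j))"
  have le2: "norm (inner_unit_normal \<Omega> x - inner_unit_normal \<Omega> y) \<le> 2"
    if "x \<in> frontier \<Omega> \<inter> U" "y \<in> frontier \<Omega> \<inter> U" for x y
    using norm_triangle_ineq4[of "inner_unit_normal \<Omega> x" "inner_unit_normal \<Omega> y"]
      convex_inner_unit_normal(1)[OF op conv U(3)[OF that(1)]]
      convex_inner_unit_normal(1)[OF op conv U(3)[OF that(2)]] by simp
  have "normal_modulus \<Omega> U t \<le> ennreal 2" for t
    unfolding normal_modulus_def
  proof (rule Sup_least)
    fix a
    assume "a \<in> {ennreal (norm (inner_unit_normal \<Omega> x - inner_unit_normal \<Omega> y)) | x y.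
            x \<in> frontier \<Omega> \<inter> U \<and> y \<in> frontier \<Omega> \<inter> U \<and> norm (x - y) < t}"
    then show "a \<le> ennreal 2" using ennreal_leI[OF le2] by blast
  qed
  then have bdd: "normal_modulus \<Omega> U t < \<infinity>" for t
    by (metis ennreal_less_top infinity_ennreal_def le_less_trans)
  show ?thesis
  proof (rule that[OF r(1)])
    show "summable ?W" by (rule Dini_normal_modulus_summable[OF fin bdd])
    show "decseq ?W"
      unfolding decseq_def
      by (intro allI impI enn2real_mono normal_modulus_mono power_decreasing) (use bdd in auto)
    fix y assume "y \<in> frontier \<Omega>" "dist p y < r"
    then show "C1_smooth_at \<Omega> y" using U(3) r by auto
  next
    fix j :: nat and x y
    assume *: "x \<in> frontier \<Omega>" "y \<in> frontier \<Omega>" "dist p x < r" "dist p y < r" "dist x y < (1/2) ^ j"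
    then have "x \<in> frontier \<Omega> \<inter> U" "y \<in> frontier \<Omega> \<inter> U" "norm (x - y) < (1/2) ^ j"
      using r by (auto simp: dist_norm)
    then have "ennreal (norm (inner_unit_normal \<Omega> x - inner_unit_normal \<Omega> y)) \<le> normal_modulus \<Omega> U ((1/2) ^ j)"
      unfolding normal_modulus_def by (intro Sup_upper) blast
    then show "norm (inner_unit_normal \<Omega> x - inner_unit_normal \<Omega> y) \<le> ?W j"
      using bdd[of "(1/2) ^ j"] by (metis enn2real_ennreal enn2real_mono infinity_ennreal_def norm_ge_zero)
  qed simp
qed

text \<open>\<open>W\<close> may drop abruptly or vanish, while the chain needs consecutive depths
  \<open>R j * V j\<close> to be comparable. Smoothing by a geometric kernel bounds the ratios of
  \<open>V\<close> on both sides: the bound 3/2, below 2, makes the depths decrease although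
  \<open>V\<close> may grow; the bound 2 keeps them from decreasing too fast. The summand 1 in
  \<open>V 0\<close> ensures positivity.\<close>

lemma dyadic_majorant:
  fixes W :: "nat \<Rightarrow> real"
  assumes sm: "summable W" and W0: "\<And>j. 0 \<le> W j" and dec: "decseq W"
  obtains V where "summable V" "\<And>j. 0 < V j" "\<And>j. W j \<le> V j"
    "\<And>j. V (Suc j) \<le> 3/2 * V j" "\<And>j. V j \<le> 2 * V (Suc j)"
proof -
  define V where "V = rec_nat (W 0 + 1) (\<lambda>j v. v / 2 + W (Suc j))"
  have V: "V 0 = W 0 + 1" "\<And>j. V (Suc j) = V j / 2 + W (Suc j)" by (simp_all add: V_def)
  have pos: "0 < V j" for j
    by (induction j) (use V W0 in \<open>auto intro: add_nonneg_pos add_pos_nonneg\<close>)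
  have ge: "W j \<le> V j" for j
    by (cases j) (use V pos in \<open>auto intro: less_imp_le\<close>)
  \<comment> \<open>The recursion summed up; it bounds the partial sums of \<open>V\<close> by those
    of \<open>W\<close>.\<close>
  have bound: "(\<Sum>j<n. V j) + 2 * V n = 2 * V 0 + 2 * (\<Sum>j<n. W (Suc j))" for n
    by (induction n) (simp_all add: V(2) algebra_simps)
  have smS: "summable (\<lambda>j. W (Suc j))" using sm by (subst summable_Suc_iff)
  have "summable V"
  proof (rule summableI_nonneg_bounded)
    fix n
    have "(\<Sum>j<n. V j) \<le> 2 * V 0 + 2 * (\<Sum>j<n. W (Suc j))" using bound[of n] pos[of n] by simp
    also have "(\<Sum>j<n. W (Suc j)) \<le> suminf (\<lambda>j. W (Suc j))"
      using smS W0 by (intro sum_le_suminf) auto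
    finally show "(\<Sum>j<n. V j) \<le> 2 * V 0 + 2 * suminf (\<lambda>j. W (Suc j))" by simp
  qed (use pos in \<open>auto intro: less_imp_le\<close>)
  moreover have "V (Suc j) \<le> 3/2 * V j" for j
    using V(2)[of j] ge[of j] decseq_SucD[OF dec, of j] by simp
  moreover have "V j \<le> 2 * V (Suc j)" for j
    using V(2)[of j] W0[of "Suc j"] by simp
  ultimately show ?thesis using that pos ge by blast
qed

text \<open>If the point were outside, some normal within \<open>4 * R\<close> of \<open>q\<close>
  would have nonpositive product with the displacement. As that normal is \<open>V\<close>-close to
  the one at \<open>q\<close>, \<open>\<zeta>\<close> would satisfy
  \<open>Re \<zeta> \<le> norm \<zeta> * V\<close>, but the given disc misses this region. The range
  \<open>4 * R\<close> is twice the bound \<open>2 * R\<close> for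
  \<open>norm \<zeta>\<close>.\<close>

lemma normal_disc_subset:
  fixes \<Omega> :: "(complex ^ 'n) set"
  assumes op: "open \<Omega>" and conv: "convex \<Omega>" and q: "q \<in> frontier \<Omega>" and R: "0 < R"
    and V: "0 \<le> V" "V \<le> 1"
    and smooth: "\<And>y. y \<in> frontier \<Omega> \<Longrightarrow> dist q y < 4 * R \<Longrightarrow> C1_smooth_at \<Omega> y"
    and close: "\<And>y. y \<in> frontier \<Omega> \<Longrightarrow> dist q y < 4 * R \<Longrightarrow>
      norm (inner_unit_normal \<Omega> q - inner_unit_normal \<Omega> y) \<le> V"
    and \<zeta>: "norm (\<zeta> - of_real R) < R - R * V\<^sup>2"
  shows "q + \<zeta> *s inner_unit_normal \<Omega> q \<in> \<Omega>"
proof (rule ccontr)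
  let ?n = "inner_unit_normal \<Omega> q" and ?x = "q + \<zeta> *s inner_unit_normal \<Omega> q"
  assume x: "?x \<notin> \<Omega>"
  have n: "norm ?n = 1" using convex_inner_unit_normal(1)[OF op conv smooth[OF q]] R by simp
  have d: "dist ?x q = norm \<zeta>" by (simp add: dist_norm norm_smult_complex n)
  have "0 \<le> R * V\<^sup>2" using R by simp
  then have "norm (\<zeta> - of_real R) < R" using \<zeta> by linarith
  then have \<zeta>2: "norm \<zeta> < 2 * R"
    using norm_triangle_ineq[of "\<zeta> - of_real R" "of_real R"] R by simp
  obtain y where y: "y \<in> frontier \<Omega>" "dist q y \<le> 2 * dist ?x q"
    "(?x - q) \<bullet> inner_unit_normal \<Omega> y \<le> 0"
    by (rule exterior_point_normal[OF op conv x q]) (use smooth d \<zeta>2 in auto)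
  have "Re \<zeta> = (\<zeta> *s ?n) \<bullet> ?n" by (simp add: smult_complex_inner n)
  also have "\<dots> \<le> (\<zeta> *s ?n) \<bullet> (?n - inner_unit_normal \<Omega> y)"
    using y(3) by (simp add: inner_diff_right)
  also have "\<dots> \<le> norm (\<zeta> *s ?n) * norm (?n - inner_unit_normal \<Omega> y)"
    by (rule norm_cauchy_schwarz)
  also have "\<dots> \<le> norm \<zeta> * V"
    using close[OF y(1)] y(2) d \<zeta>2 by (simp add: norm_smult_complex n mult_left_mono)
  finally have re: "Re \<zeta> \<le> norm \<zeta> * V" .
  \<comment> \<open>The distance from \<open>R\<close> to the region is at least
    \<open>R * sqrt (1 - V\<^sup>2)\<close>, hence at least \<open>R * (1 - V\<^sup>2)\<close>; the
    computation is this with squares.\<close>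
  have "R\<^sup>2 - R\<^sup>2 * V\<^sup>2 \<le> (norm \<zeta>)\<^sup>2 - 2 * R * (norm \<zeta> * V) + R\<^sup>2"
    using zero_le_power2[of "norm \<zeta> - R * V"] by (simp add: power2_eq_square algebra_simps)
  also have "\<dots> \<le> (norm \<zeta>)\<^sup>2 - 2 * R * Re \<zeta> + R\<^sup>2"
    using re R by simp
  also have "\<dots> = (norm (\<zeta> - of_real R))\<^sup>2"
    unfolding cmod_power2 by (simp add: power2_eq_square algebra_simps)
  also have "\<dots> < (R - R * V\<^sup>2)\<^sup>2"
    using \<zeta> by (intro power_strict_mono) auto
  also have "\<dots> = R\<^sup>2 - R\<^sup>2 * V\<^sup>2 - R\<^sup>2 * (V\<^sup>2 * (1 - V\<^sup>2))"
    by (simp add: power2_eq_square algebra_simps)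
  also have "\<dots> \<le> R\<^sup>2 - R\<^sup>2 * V\<^sup>2"
    using V by (simp add: power_le_one)
  finally show False by simp
qed

text \<open>The scales are \<open>R\<^sub>j = 2\<^sup>-\<^sup>j / 4\<close>, and depth \<open>R\<^sub>j V\<^sub>j\<close> is where the two
  errors in \<open>disc_chain_normal_step\<close> balance; both are then of order \<open>V\<^sub>j\<close>.\<close>

lemma disc_chain_normal:
  fixes V :: "nat \<Rightarrow> real" and q v :: "complex ^ 'n"
  defines "R \<equiv> \<lambda>j. (1/2) ^ j / 4"
  assumes V: "summable V" "\<And>j. 0 < V j" "\<And>j. V (Suc j) \<le> 3/2 * V j" "\<And>j. V j \<le> 2 * V (Suc j)"
    and small: "\<And>j. j0 \<le> j \<Longrightarrow> V j \<le> 1/8"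
    and disc: "\<And>j \<zeta>. j0 \<le> j \<Longrightarrow> norm (\<zeta> - of_real (R j)) < R j - R j * (V j)\<^sup>2 \<Longrightarrow> q + \<zeta> *s v \<in> \<Omega>"
    and t: "0 < t" "t \<le> R j0 * V j0"
  shows "\<exists>L \<le> ln (R j0 * V j0 / t) / 2 + 5 * suminf V.
    disc_chain \<Omega> (q + (R j0 * V j0) *\<^sub>R v) (q + t *\<^sub>R v) L"
proof -
  define T where "T j = R j * V j" for j
  have R: "0 < R j" "R (Suc j) = R j / 2" for j by (simp_all add: R_def)
  have T0: "0 < T j" for j using R V(2) by (simp add: T_def)
  have Tdec: "T (Suc j) \<le> T j" for j
  proof -
    have "T (Suc j) \<le> R j / 2 * (3/2 * V j)"
      unfolding T_def R(2) using R(1)[of j] by (intro mult_left_mono V) simp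
    also have "\<dots> \<le> T j" using R(1)[of j] V(2)[of j] by (simp add: T_def)
    finally show ?thesis .
  qed
  have step: "\<exists>L \<le> ln (T j / s) / 2 + 5 * V j. disc_chain \<Omega> (q + T j *\<^sub>R v) (q + s *\<^sub>R v) L"
    if j: "j0 \<le> j" and s: "T (Suc j) \<le> s" "s \<le> T j" for j s
  proof -
    have s0: "0 < s" using T0[of "Suc j"] s by linarith
    \<comment> \<open>Halving \<open>R\<close> and at most halving \<open>V\<close> gives
      \<open>R j * V j \<le> 4 * T (Suc j)\<close>. So the gap costs at most \<open>4 * V j\<close>
      relative to \<open>s\<close>; with \<open>T j / R j = V j\<close> for the curvature this makes
      the constant 5.\<close>
    have "R j * (V j)\<^sup>2 = 4 * V j * (R j / 2 * (V j / 2))" by (simp add: power2_eq_square)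
    also have "\<dots> \<le> 4 * V j * (R j / 2 * V (Suc j))"
      using V(2)[of j] V(4)[of j] R(1)[of j] by (intro mult_left_mono) auto
    also have "\<dots> \<le> 4 * V j * s"
      using s V(2)[of j] by (intro mult_left_mono) (auto simp: T_def R(2))
    finally have \<tau>: "R j * (V j)\<^sup>2 \<le> 4 * V j * s" .
    have "4 * V j * s \<le> s / 2" using small[OF j] s0 by simp
    with \<tau> have \<tau>2: "R j * (V j)\<^sup>2 \<le> s / 2" by linarith
    have tR: "T j \<le> R j / 2" using small[OF j] R(1)[of j] by (simp add: T_def)
    have "0 \<le> R j * (V j)\<^sup>2" using R(1)[of j] by simp
    from disc_chain_normal_step[OF disc[OF j] s0 s(2) this \<tau>2 tR]
    obtain L where L: "L \<le> ln (T j / s) / 2 + R j * (V j)\<^sup>2 / s + T j / R j"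
      "disc_chain \<Omega> (q + T j *\<^sub>R v) (q + s *\<^sub>R v) L" by blast
    have "R j * (V j)\<^sup>2 / s \<le> 4 * V j" using \<tau> s0 by (simp add: divide_le_eq)
    moreover have "T j / R j = V j" using R(1)[of j] by (simp add: T_def)
    ultimately have "L \<le> ln (T j / s) / 2 + 5 * V j" using L(1) by linarith
    with L(2) show ?thesis by blast
  qed
  \<comment> \<open>The logarithms of the depth ratios telescope exactly, so only the errors
    accumulate.\<close>
  have chain: "\<exists>L \<le> ln (T j0 / s) / 2 + 5 * (\<Sum>i\<le>n. V (j0 + i)).
      disc_chain \<Omega> (q + T j0 *\<^sub>R v) (q + s *\<^sub>R v) L"
    if "T (Suc (j0 + n)) \<le> s" "s \<le> T (j0 + n)" for n s
    using that
  proof (induction n arbitrary: s)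
    case 0
    then show ?case using step[of j0 s] by simp
  next
    case (Suc n)
    let ?u = "T (Suc (j0 + n))"
    obtain L where L: "L \<le> ln (T j0 / ?u) / 2 + 5 * (\<Sum>i\<le>n. V (j0 + i))"
      "disc_chain \<Omega> (q + T j0 *\<^sub>R v) (q + ?u *\<^sub>R v) L"
      using Suc.IH[of ?u] Tdec by auto
    obtain M where M: "M \<le> ln (?u / s) / 2 + 5 * V (Suc (j0 + n))"
      "disc_chain \<Omega> (q + ?u *\<^sub>R v) (q + s *\<^sub>R v) M"
      using step[of "Suc (j0 + n)" s] Suc.prems by auto
    have s0: "0 < s" using T0 Suc.prems(1) by (rule less_le_trans)
    have "ln (T j0 / s) = ln (T j0 / ?u) + ln (?u / s)"
      using T0[of j0] T0[of "Suc (j0 + n)"] s0 by (simp add: ln_div)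
    then have "L + M \<le> ln (T j0 / s) / 2 + 5 * (\<Sum>i\<le>Suc n. V (j0 + i))"
      using L(1) M(1) by (simp add: add_divide_distrib)
    then show ?case using disc_chain_trans[OF M(2) L(2)] by blast
  qed
  obtain n where n: "T (Suc (j0 + n)) \<le> t" "t \<le> T (j0 + n)"
  proof -
    obtain m where m: "(1/2::real) ^ m < t" using real_arch_pow_inv[of t "1/2"] t by auto
    have "T (j0 + m) \<le> (1/2) ^ (j0 + m) / 4 * (1/8)"
      unfolding T_def R_def by (intro mult_left_mono small) auto
    also have "\<dots> \<le> (1/2) ^ (j0 + m)" by simp
    also have "\<dots> \<le> (1/2) ^ m" by (intro power_decreasing) auto
    finally have ex: "T (j0 + m) \<le> t" using m by simp
    \<comment> \<open>The depths \<open>T\<close> fall below \<open>t\<close>, and the first index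
      where this happens locates \<open>t\<close> between consecutive depths. Index 0 forces
      \<open>t = T j0\<close>, since \<open>t\<close> is at most \<open>T j0\<close>.\<close>
    define k where "k = (LEAST k. T (j0 + k) \<le> t)"
    have k: "T (j0 + k) \<le> t" unfolding k_def by (rule LeastI, rule ex)
    show ?thesis
    proof (cases k)
      case 0
      then have "t = T j0" using k t(2) by (simp add: T_def)
      then show ?thesis using that[of 0] Tdec[of j0] by simp
    next
      case (Suc l)
      then have "\<not> T (j0 + l) \<le> t" using not_less_Least[of l "\<lambda>k. T (j0 + k) \<le> t"] k_def by simp
      then show ?thesis using that[of l] k Suc by simp
    qed
  qed
  have "(\<Sum>i\<le>n. V (j0 + i)) = (\<Sum>i\<in>{j0..j0 + n}. V i)"
    by (rule sum.reindex_bij_witness[of _ "\<lambda>i. i - j0" "\<lambda>i. j0 + i"]) auto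
  also have "\<dots> \<le> suminf V" using V(1,2) by (intro sum_le_suminf) (auto intro: less_imp_le)
  finally have S: "(\<Sum>i\<le>n. V (j0 + i)) \<le> suminf V" .
  obtain L where L: "L \<le> ln (T j0 / t) / 2 + 5 * (\<Sum>i\<le>n. V (j0 + i))"
    "disc_chain \<Omega> (q + T j0 *\<^sub>R v) (q + t *\<^sub>R v) L"
    using chain[OF n] by blast
  then have "L \<le> ln (T j0 / t) / 2 + 5 * suminf V" using S by linarith
  with L(2) show ?thesis unfolding T_def by blast
qed

text \<open>A chain of uniformly bounded length reaches depth \<open>t0\<close> on the normal
  through \<open>q\<close>, and \<open>disc_chain_normal\<close> descends from there to
  \<open>x\<close>. Uniformity holds because the points at depth \<open>t0\<close> over boundary
  points near \<open>p\<close> stay in one compact ball inside the domain.\<close>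

lemma Dini_boundary_estimate:
  fixes \<Omega> :: "(complex ^ 'n) set"
  assumes op: "open \<Omega>" and conv: "convex \<Omega>" and c: "c \<in> \<Omega>" and Dini: "C1_Dini_smooth_at \<Omega> p"
  obtains r M where "r > 0"
    "\<And>x q. x \<in> \<Omega> \<Longrightarrow> dist p x < r \<Longrightarrow> q \<in> frontier \<Omega> \<Longrightarrow>
       (\<And>y. y \<in> frontier \<Omega> \<Longrightarrow> dist x q \<le> dist x y) \<Longrightarrow>
       \<exists>L \<le> M + ln (1 / dist x q) / 2. disc_chain \<Omega> c x L"
proof -
  let ?n = "inner_unit_normal \<Omega>"
  have p: "p \<in> frontier \<Omega>" using Dini by (simp add: C1_Dini_smooth_at_def)
  obtain r0 and W :: "nat \<Rightarrow> real" where r0: "r0 > 0" and W: "summable W" "decseq W" "\<And>j. 0 \<le> W j"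
    and smooth: "\<And>y. y \<in> frontier \<Omega> \<Longrightarrow> dist p y < r0 \<Longrightarrow> C1_smooth_at \<Omega> y"
    and mod: "\<And>j x y. x \<in> frontier \<Omega> \<Longrightarrow> y \<in> frontier \<Omega> \<Longrightarrow> dist p x < r0 \<Longrightarrow> dist p y < r0 \<Longrightarrow>
       dist x y < (1/2) ^ j \<Longrightarrow> norm (?n x - ?n y) \<le> W j"
    using C1_Dini_normal_modulus[OF op conv Dini] by blast
  obtain V where V: "summable V" "\<And>j. 0 < V j" "\<And>j. W j \<le> V j"
    "\<And>j. V (Suc j) \<le> 3/2 * V j" "\<And>j. V j \<le> 2 * V (Suc j)"
    using dyadic_majorant[OF W(1,3,2)] by blast
  have half0: "(\<lambda>j. (1/2::real) ^ j) \<longlonglongrightarrow> 0" by (intro LIMSEQ_power_zero) auto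
  have "\<forall>\<^sub>F j in sequentially. V j < 1/8 \<and> (1/2) ^ j < r0 / 2"
    using order_tendstoD(2)[OF summable_LIMSEQ_zero[OF V(1)], of "1/8"] order_tendstoD(2)[OF half0, of "r0/2"] r0
    by (auto intro: eventually_conj)
  then obtain j0 where j0: "\<And>j. j0 \<le> j \<Longrightarrow> V j < 1/8" "\<And>j. j0 \<le> j \<Longrightarrow> (1/2) ^ j < r0 / 2"
    by (auto simp: eventually_sequentially)
  have disc: "q + \<zeta> *s ?n q \<in> \<Omega>"
    if q: "q \<in> frontier \<Omega>" "dist p q < r0 / 2" and j: "j0 \<le> j"
      and \<zeta>: "norm (\<zeta> - of_real ((1/2) ^ j / 4)) < (1/2) ^ j / 4 - (1/2) ^ j / 4 * (V j)\<^sup>2" for q j \<zeta>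
  proof (rule normal_disc_subset[OF op conv q(1) _ _ _ _ _ \<zeta>])
    show "V j \<le> 1" "0 \<le> V j" using V(2)[of j] j0(1)[OF j] by auto
    fix y assume y: "y \<in> frontier \<Omega>" "dist q y < 4 * ((1/2) ^ j / 4)"
    have "dist p y < r0" using dist_triangle[of p y q] q(2) y(2) j0(2)[OF j] by simp
    then show "C1_smooth_at \<Omega> y" "norm (?n q - ?n y) \<le> V j"
      using smooth mod[of q y j] y q r0 V(3)[of j] by auto
  qed simp
  define t0 where "t0 = (1/2) ^ j0 / 4 * V j0"
  have t0: "0 < t0" using V(2) by (simp add: t0_def)
  \<comment> \<open>As \<open>V j0 < 1\<close>, the depth \<open>t0\<close> exceeds the gap
    \<open>R * V\<^sup>2\<close> with \<open>R = (1/2) ^ j0 / 4\<close>, so the point lies in the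
    tangent disc of scale \<open>j0\<close>.\<close>
  have bp: "p + t0 *\<^sub>R ?n p \<in> \<Omega>"
  proof -
    have R: "0 < (1/2::real) ^ j0 / 4" by simp
    have "V j0 * V j0 < V j0 * 1"
      using V(2)[of j0] j0(1)[of j0] by (intro mult_strict_left_mono) auto
    then have "(1/2) ^ j0 / 4 * (V j0)\<^sup>2 < t0"
      unfolding t0_def power2_eq_square by (intro mult_strict_left_mono R) simp
    moreover have "t0 \<le> (1/2) ^ j0 / 4"
      unfolding t0_def using j0(1)[of j0] by (simp add: divide_simps)
    ultimately have "norm (complex_of_real t0 - of_real ((1/2) ^ j0 / 4)) < (1/2) ^ j0 / 4 - (1/2) ^ j0 / 4 * (V j0)\<^sup>2"
      unfolding of_real_diff[symmetric] norm_of_real by simp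
    from disc[OF p _ order_refl this] r0 show ?thesis by (simp add: scaleR_eq_smult)
  qed
  obtain \<eta> where \<eta>: "\<eta> > 0" "cball (p + t0 *\<^sub>R ?n p) \<eta> \<subseteq> \<Omega>"
    using op bp open_contains_cball by blast
  obtain M0 where M0: "\<And>x. x \<in> cball (p + t0 *\<^sub>R ?n p) \<eta> \<Longrightarrow> \<exists>L\<le>M0. disc_chain \<Omega> c x L"
    using disc_chain_compact_bound[OF op convex_connected[OF conv] c compact_cball \<eta>(2)] by blast
  have "(\<lambda>j. (1/2) ^ j + t0 * W j) \<longlonglongrightarrow> 0 + t0 * 0"
    by (intro tendsto_intros half0 summable_LIMSEQ_zero W(1))
  then have "\<forall>\<^sub>F j in sequentially. (1/2) ^ j + t0 * W j < \<eta>"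
    using \<eta> by (intro order_tendstoD) auto
  then obtain j1 where j1: "(1/2) ^ j1 + t0 * W j1 < \<eta>"
    by (auto simp: eventually_sequentially)
  \<comment> \<open>Since \<open>dist p q < 2 * r\<close>, the first two bounds bring
    \<open>q\<close> into the range of \<open>W j1\<close> and of \<open>disc\<close>; the third
    makes the depth of \<open>x\<close> at most \<open>t0\<close>.\<close>
  define r where "r = min (min ((1/2) ^ j1 / 2) (r0 / 4)) t0"
  have r: "0 < r" "2 * r \<le> (1/2) ^ j1" "2 * r \<le> r0 / 2" "r \<le> t0"
    using r0 t0 by (auto simp: r_def min_def)
  show thesis
  proof (rule that[OF r(1)])
    fix x q
    assume x: "x \<in> \<Omega>" "dist p x < r" and q: "q \<in> frontier \<Omega>"
      and near: "\<And>y. y \<in> frontier \<Omega> \<Longrightarrow> dist x q \<le> dist x y"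
    let ?d = "dist x q"
    have d: "?d < r" using near[OF p] x(2) by (simp add: dist_commute)
    have dpos: "0 < ?d" using x q op by (auto simp: frontier_def interior_open)
    have pq: "dist p q < 2 * r" using dist_triangle[of p q x] d x(2) by simp
    have sm: "C1_smooth_at \<Omega> q" using smooth[OF q] pq r(3) r0 by linarith
    have xq: "x = q + ?d *\<^sub>R ?n q"
      by (rule nearest_frontier_point_normal[OF op conv x(1) q near sm])
    have "norm (?n p - ?n q) \<le> W j1"
      using pq r r0 by (intro mod p q) auto
    then have "norm (t0 *\<^sub>R (?n p - ?n q)) \<le> t0 * W j1" using t0 by simp
    moreover have "dist (p + t0 *\<^sub>R ?n p) (q + t0 *\<^sub>R ?n q) \<le> dist p q + norm (t0 *\<^sub>R (?n p - ?n q))"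
      using norm_triangle_ineq[of "p - q" "t0 *\<^sub>R (?n p - ?n q)"]
      by (simp add: dist_norm algebra_simps)
    ultimately have "q + t0 *\<^sub>R ?n q \<in> cball (p + t0 *\<^sub>R ?n p) \<eta>"
      using j1 pq r(2) by simp
    then obtain L where L: "L \<le> M0" "disc_chain \<Omega> c (q + t0 *\<^sub>R ?n q) L" using M0 by blast
    have "\<exists>L \<le> ln (t0 / ?d) / 2 + 5 * suminf V. disc_chain \<Omega> (q + t0 *\<^sub>R ?n q) (q + ?d *\<^sub>R ?n q) L"
      unfolding t0_def
    proof (rule disc_chain_normal[OF V(1,2,4,5)])
      show "V j \<le> 1/8" if "j0 \<le> j" for j using j0(1)[OF that] by simp
      show "q + \<zeta> *s ?n q \<in> \<Omega>"
        if "j0 \<le> j" "norm (\<zeta> - of_real ((1/2) ^ j / 4)) < (1/2) ^ j / 4 - (1/2) ^ j / 4 * (V j)\<^sup>2" for j \<zeta>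
        using disc[OF q _ that] pq r(3) by linarith
      show "?d \<le> (1/2) ^ j0 / 4 * V j0" using d r(4) by (simp add: t0_def)
    qed (rule dpos)
    then obtain K where K: "K \<le> ln (t0 / ?d) / 2 + 5 * suminf V"
      "disc_chain \<Omega> (q + t0 *\<^sub>R ?n q) x K" using xq by auto
    have "ln (t0 / ?d) = ln t0 + ln (1 / ?d)" using t0 dpos by (simp add: ln_div)
    then have "L + K \<le> (M0 + ln t0 / 2 + 5 * suminf V) + ln (1 / ?d) / 2"
      using L(1) K(1) by (simp add: add_divide_distrib)
    then show "\<exists>L \<le> (M0 + ln t0 / 2 + 5 * suminf V) + ln (1 / ?d) / 2. disc_chain \<Omega> c x L"
      using disc_chain_trans[OF K(2) L(2)] by blast
  qed
qed

section \<open>Separation of boundary points\<close>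

text \<open>The Cayley transform \<open>\<psi>\<close> sends \<open>g z\<close> to 0, and
  \<open>1 - (norm (\<psi> \<zeta>))\<^sup>2\<close> equals \<open>4 * \<delta> * Re (g \<zeta>) /
  (norm (g \<zeta> + \<delta>))\<^sup>2\<close>, which is at most \<open>4 * \<delta> / c\<close>
  however large \<open>g \<zeta>\<close> is. Schwarz-Pick carries this over to the pseudohyperbolic
  distance of \<open>z\<close> and \<open>\<zeta>\<close>.\<close>

lemma half_plane_Schwarz_Pick:
  assumes hol: "g holomorphic_on ball 0 1" and re: "\<And>u. norm u < 1 \<Longrightarrow> 0 < Re (g u)"
    and z: "norm z < 1" and \<zeta>: "norm \<zeta> < 1" and gz: "g z = of_real \<delta>"
    and c: "0 < c" "c \<le> norm (g \<zeta>)"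
  shows "(1 - (norm z)\<^sup>2) * (1 - (norm \<zeta>)\<^sup>2) \<le> 4 * \<delta> / c * (norm (1 - cnj z * \<zeta>))\<^sup>2"
proof -
  have \<delta>: "0 < \<delta>" using re[OF z] gz by simp
  define \<psi> where "\<psi> u = (g u - of_real \<delta>) / (g u + of_real \<delta>)" for u
  have nz: "g u + of_real \<delta> \<noteq> 0" if "norm u < 1" for u
    using re[OF that] \<delta> by (auto simp: complex_eq_iff)
  have diff: "(norm (g u + of_real \<delta>))\<^sup>2 - (norm (g u - of_real \<delta>))\<^sup>2 = 4 * \<delta> * Re (g u)" for u
    unfolding cmod_power2 by (simp add: power2_eq_square algebra_simps)
  have lt1: "norm (\<psi> u) < 1" if "norm u < 1" for u
  proof -
    have "0 < 4 * \<delta> * Re (g u)" using \<delta> re[OF that] by simp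
    then have "(norm (g u - of_real \<delta>))\<^sup>2 < (norm (g u + of_real \<delta>))\<^sup>2" using diff[of u] by linarith
    then have "norm (g u - of_real \<delta>) < norm (g u + of_real \<delta>)"
      by (rule power2_less_imp_less) simp
    then show ?thesis using nz[OF that] by (simp add: \<psi>_def norm_divide)
  qed
  have "\<psi> holomorphic_on ball 0 1"
    unfolding \<psi>_def using nz by (intro holomorphic_intros hol) auto
  then have "poincare_dist (\<psi> \<zeta>) (\<psi> z) \<le> poincare_dist \<zeta> z"
    using lt1 \<zeta> z by (intro Schwarz_Pick_poincare_dist)
  moreover have "\<psi> z = 0" by (simp add: \<psi>_def gz)
  moreover define x y where "x = norm (\<psi> \<zeta>)" and "y = norm ((\<zeta> - z) / (1 - cnj z * \<zeta>))"
  ultimately have "artanh x \<le> artanh y" by (simp add: poincare_dist_def)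
  have x: "0 \<le> x" "x < 1" and y: "0 \<le> y" "y < 1"
    using lt1[OF \<zeta>] pseudo_dist_less_1[OF \<zeta> z] by (auto simp: x_def y_def)
  have "x \<le> y"
  proof -
    have "exp (2 * artanh x) \<le> exp (2 * artanh y)" using \<open>artanh x \<le> artanh y\<close> by simp
    then have "(1 + x) / (1 - x) \<le> (1 + y) / (1 - y)" by (simp add: exp_two_artanh x y)
    then have "(1 + x) * (1 - y) \<le> (1 + y) * (1 - x)" using x y by (simp add: divide_simps mult.commute)
    then show ?thesis by (simp add: algebra_simps)
  qed
  then have "1 - y\<^sup>2 \<le> 1 - x\<^sup>2" using x by (simp add: power_mono)
  also have "1 - x\<^sup>2 \<le> 4 * \<delta> / c"
  proof -
    let ?D = "(norm (g \<zeta> + of_real \<delta>))\<^sup>2"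
    have D: "0 < ?D" using nz[OF \<zeta>] by simp
    have "1 - x\<^sup>2 = 4 * \<delta> * Re (g \<zeta>) / ?D"
    proof -
      have "x\<^sup>2 = (norm (g \<zeta> - of_real \<delta>))\<^sup>2 / ?D"
        by (simp add: x_def \<psi>_def norm_divide power_divide)
      then have "1 - x\<^sup>2 = (?D - (norm (g \<zeta> - of_real \<delta>))\<^sup>2) / ?D"
        using D by (simp add: diff_divide_distrib)
      then show ?thesis by (simp only: diff)
    qed
    also have "c * Re (g \<zeta>) \<le> norm (g \<zeta>) * norm (g \<zeta>)"
      using c re[OF \<zeta>] complex_Re_le_cmod[of "g \<zeta>"] by (intro mult_mono) auto
    then have "c * Re (g \<zeta>) \<le> ?D"
    proof -
      have "?D = norm (g \<zeta>) * norm (g \<zeta>) + 2 * \<delta> * Re (g \<zeta>) + \<delta>\<^sup>2"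
        unfolding power2_eq_square[of "norm (g \<zeta>)", symmetric] cmod_power2
        by (simp add: power2_eq_square algebra_simps)
      moreover have "0 \<le> 2 * \<delta> * Re (g \<zeta>)" using \<delta> re[OF \<zeta>] by simp
      ultimately show ?thesis
        using \<open>c * Re (g \<zeta>) \<le> norm (g \<zeta>) * norm (g \<zeta>)\<close> zero_le_power2[of \<delta>] by linarith
    qed
    then have "4 * \<delta> * Re (g \<zeta>) / ?D \<le> 4 * \<delta> / c"
      using D c \<delta> by (simp add: divide_simps mult.commute mult.left_commute)
    finally show ?thesis .
  qed
  finally have le: "1 - y\<^sup>2 \<le> 4 * \<delta> / c" .
  have nz1: "1 - cnj z * \<zeta> \<noteq> 0"
  proof
    assume "1 - cnj z * \<zeta> = 0"
    then have "norm (cnj z * \<zeta>) = 1" by simp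
    moreover have "norm z * norm \<zeta> \<le> 1 * norm \<zeta>" using z by (intro mult_right_mono) auto
    ultimately show False using \<zeta> by (simp add: norm_mult)
  qed
  have eq: "(norm (1 - cnj z * \<zeta>))\<^sup>2 - (norm (\<zeta> - z))\<^sup>2 = (1 - (norm z)\<^sup>2) * (1 - (norm \<zeta>)\<^sup>2)"
    unfolding cmod_power2 by (simp add: power2_eq_square algebra_simps)
  have "(1 - (norm z)\<^sup>2) * (1 - (norm \<zeta>)\<^sup>2) = (1 - y\<^sup>2) * (norm (1 - cnj z * \<zeta>))\<^sup>2"
  proof -
    let ?D = "(norm (1 - cnj z * \<zeta>))\<^sup>2"
    have D: "?D \<noteq> 0" using nz1 by simp
    have "y\<^sup>2 = (norm (\<zeta> - z))\<^sup>2 / ?D" by (simp add: y_def norm_divide power_divide)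
    then have "(1 - y\<^sup>2) * ?D = ?D - (norm (\<zeta> - z))\<^sup>2"
      using D by (simp add: left_diff_distrib)
    then show ?thesis using eq by simp
  qed
  also have "\<dots> \<le> 4 * \<delta> / c * (norm (1 - cnj z * \<zeta>))\<^sup>2"
    using le by (intro mult_right_mono) auto
  finally show ?thesis .
qed

text \<open>At \<open>p\<close> itself the functional has no zero on the compact set
  \<open>K\<close>, by strict convexity. Continuity of the normal extends the lower bound to all
  \<open>q\<close> near \<open>p\<close>, with half the constant.\<close>

lemma C_strictly_convex_separation:
  fixes \<Omega> :: "(complex ^ 'n) set"
  assumes op: "open \<Omega>" and conv: "convex \<Omega>" and bdd: "bounded \<Omega>"
    and Dini: "C1_Dini_smooth_at \<Omega> p" and strict: "C_strictly_convex_at \<Omega> p" and \<epsilon>: "\<epsilon> > 0"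
  obtains r c where "r > 0" "c > 0"
    "\<And>q m. q \<in> frontier \<Omega> \<Longrightarrow> dist p q < r \<Longrightarrow> m \<in> closure \<Omega> \<Longrightarrow> \<epsilon> \<le> dist p m \<Longrightarrow>
       C1_smooth_at \<Omega> q \<and> c \<le> norm (herm (m - q) (inner_unit_normal \<Omega> q))"
proof -
  let ?n = "inner_unit_normal \<Omega>"
  define K where "K = closure \<Omega> - ball p \<epsilon>"
  have K: "compact K" using bdd by (simp add: K_def compact_closure compact_diff)
  have p: "p \<in> frontier \<Omega>" using Dini by (simp add: C1_Dini_smooth_at_def)
  have nz: "herm (m - p) (?n p) \<noteq> 0" if "m \<in> K" for m
  proof
    assume "herm (m - p) (?n p) = 0"
    then have "m - p \<in> complex_tangent_space \<Omega> p" by (simp add: herm_eq_0_iff)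
    then have "p + (m - p) \<in> (\<lambda>v. p + v) ` complex_tangent_space \<Omega> p" by (rule imageI)
    then have "m \<in> {p}" using that strict by (auto simp: C_strictly_convex_at_def K_def)
    then show False using that \<epsilon> by (simp add: K_def)
  qed
  have cont: "continuous_on K (\<lambda>m. norm (herm (m - p) (?n p)))"
    unfolding herm_def by (intro continuous_intros)
  obtain a where a: "a > 0" "\<And>m. m \<in> K \<Longrightarrow> a \<le> norm (herm (m - p) (?n p))"
  proof (cases "K = {}")
    case True
    then show ?thesis using that[of 1] by simp
  next
    case False
    then obtain m0 where "m0 \<in> K" "\<And>m. m \<in> K \<Longrightarrow> norm (herm (m0 - p) (?n p)) \<le> norm (herm (m - p) (?n p))"
      using continuous_attains_inf[OF K False cont] by blast
    then show ?thesis using that[of "norm (herm (m0 - p) (?n p))"] nz by simp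
  qed
  obtain B where B: "B > 0" "\<And>m. m \<in> K \<Longrightarrow> norm (m - p) \<le> B"
  proof -
    have "bounded ((\<lambda>m. m - p) ` K)"
      by (intro compact_imp_bounded compact_continuous_image K continuous_intros)
    then show ?thesis using that unfolding bounded_pos by auto
  qed
  obtain r0 and W :: "nat \<Rightarrow> real" where r0: "r0 > 0" and W: "summable W" and "decseq W" "\<And>j. 0 \<le> W j"
    and smooth: "\<And>y. y \<in> frontier \<Omega> \<Longrightarrow> dist p y < r0 \<Longrightarrow> C1_smooth_at \<Omega> y"
    and mod: "\<And>j x y. x \<in> frontier \<Omega> \<Longrightarrow> y \<in> frontier \<Omega> \<Longrightarrow> dist p x < r0 \<Longrightarrow> dist p y < r0 \<Longrightarrow>
       dist x y < (1/2) ^ j \<Longrightarrow> norm (?n x - ?n y) \<le> W j"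
    using C1_Dini_normal_modulus[OF op conv Dini] by blast
  have "\<forall>\<^sub>F j in sequentially. W j < a / (4 * B)"
    using order_tendstoD(2)[OF summable_LIMSEQ_zero[OF W]] a B by simp
  then obtain j where j: "W j < a / (4 * B)" by (auto simp: eventually_sequentially)
  \<comment> \<open>Half of the minimum \<open>a\<close> may be lost: \<open>a / 4\<close> by
    turning the normal, where \<open>B\<close> bounds \<open>m - p\<close>, and \<open>a / 4\<close>
    by moving the base point.\<close>
  define r where "r = min (min r0 ((1/2) ^ j)) (a / 4)"
  show thesis
  proof (rule that)
    show "r > 0" "a / 2 > 0" using r0 a by (simp_all add: r_def)
    fix q m assume q: "q \<in> frontier \<Omega>" "dist p q < r" and m: "m \<in> closure \<Omega>" "\<epsilon> \<le> dist p m"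
    then have mK: "m \<in> K" by (simp add: K_def)
    have sm: "C1_smooth_at \<Omega> q" using smooth q by (simp add: r_def)
    have n: "norm (?n q) = 1" using convex_inner_unit_normal(1)[OF op conv sm] .
    have "norm (?n p - ?n q) \<le> W j" using q r0 by (intro mod p) (auto simp: r_def)
    then have nn: "norm (?n p - ?n q) \<le> a / (4 * B)" using j by simp
    have "herm (m - p) (?n p) - herm (m - q) (?n q) = herm (m - p) (?n p - ?n q) - herm (p - q) (?n q)"
      by (simp add: herm_diff_left herm_diff_right)
    also have "norm \<dots> \<le> norm (herm (m - p) (?n p - ?n q)) + norm (herm (p - q) (?n q))"
      by (rule norm_triangle_ineq4)
    also have "norm (herm (m - p) (?n p - ?n q)) \<le> norm (m - p) * norm (?n p - ?n q)"
      by (rule norm_herm_le)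
    also have "\<dots> \<le> B * (a / (4 * B))" using B mK nn by (intro mult_mono) auto
    also have "\<dots> = a / 4" using B by simp
    also have "norm (herm (p - q) (?n q)) \<le> norm (p - q) * norm (?n q)"
      by (rule norm_herm_le)
    also have "\<dots> \<le> a / 4" using q(2) n by (simp add: r_def dist_norm)
    finally have "norm (herm (m - p) (?n p) - herm (m - q) (?n q)) \<le> a / 2" by simp
    moreover have "norm (herm (m - p) (?n p)) - norm (herm (m - q) (?n q))
        \<le> norm (herm (m - p) (?n p) - herm (m - q) (?n q))" by (rule norm_triangle_ineq2)
    ultimately show "C1_smooth_at \<Omega> q \<and> a / 2 \<le> norm (herm (m - q) (?n q))"
      using a(2)[OF mK] sm by linarith
  qed
qed

section \<open>Estimates along a complex geodesic\<close>

lemma holomorphic_disc_continuous: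
  assumes "holomorphic_disc \<Omega> \<phi>"
  shows "continuous_on (ball 0 1) \<phi>"
proof -
  have "continuous_on (ball 0 1) (\<lambda>z. \<chi> i. \<phi> z $ i)"
    using assms by (intro continuous_on_vec_lambda holomorphic_on_imp_continuous_on)
      (simp add: holomorphic_disc_def)
  then show ?thesis by simp
qed

lemma complex_geodesic_artanh_le:
  assumes "complex_geodesic \<Omega> f" "disc_chain \<Omega> (f 0) (f z) L" "norm z < 1"
  shows "artanh (norm z) \<le> L"
proof -
  have "kobayashi_dist \<Omega> (f 0) (f z) = poincare_dist 0 z"
    using assms by (simp add: complex_geodesic_def)
  then show ?thesis
    using kobayashi_dist_le_disc_chain[OF assms(2)] by (simp add: poincare_dist_def)
qed

text \<open>The chain estimate bounds the boundary distance of \<open>f z\<close> by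
  \<open>exp (2 * M) * (1 - norm z)\<close>. Inserted into \<open>half_plane_Schwarz_Pick\<close>,
  this lets the factor \<open>1 - norm z\<close> cancel, so \<open>C\<close> does not depend on how
  close \<open>z\<close> is to the circle.\<close>

lemma geodesic_separation_estimate:
  fixes \<Omega> :: "(complex ^ 'n) set"
  assumes op: "open \<Omega>" and conv: "convex \<Omega>" and bdd: "bounded \<Omega>" and geo: "complex_geodesic \<Omega> f"
    and Dini: "C1_Dini_smooth_at \<Omega> p" and strict: "C_strictly_convex_at \<Omega> p" and \<epsilon>: "\<epsilon> > 0"
  obtains r C where "r > 0" "C > 0"
    "\<And>z \<zeta>. norm z < 1 \<Longrightarrow> norm \<zeta> < 1 \<Longrightarrow> dist p (f z) < r \<Longrightarrow> \<epsilon> \<le> dist p (f \<zeta>) \<Longrightarrow>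
       1 - (norm \<zeta>)\<^sup>2 \<le> C * (norm (1 - cnj z * \<zeta>))\<^sup>2"
proof -
  let ?n = "inner_unit_normal \<Omega>"
  have p: "p \<in> frontier \<Omega>" using Dini by (simp add: C1_Dini_smooth_at_def)
  have fhol: "(\<lambda>z. f z $ i) holomorphic_on ball 0 1" for i
    using geo by (simp add: complex_geodesic_def holomorphic_disc_def)
  have f\<Omega>: "f z \<in> \<Omega>" if "norm z < 1" for z
    using geo that by (auto simp: complex_geodesic_def holomorphic_disc_def)
  have f0: "f 0 \<in> \<Omega>" using f\<Omega> by simp
  obtain r1 M where r1: "r1 > 0"
    and M: "\<And>x q. x \<in> \<Omega> \<Longrightarrow> dist p x < r1 \<Longrightarrow> q \<in> frontier \<Omega> \<Longrightarrow>
       (\<And>y. y \<in> frontier \<Omega> \<Longrightarrow> dist x q \<le> dist x y) \<Longrightarrow>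
       \<exists>L \<le> M + ln (1 / dist x q) / 2. disc_chain \<Omega> (f 0) x L"
    using Dini_boundary_estimate[OF op conv f0 Dini] by blast
  obtain r2 c where r2: "r2 > 0" and c: "c > 0"
    and sep: "\<And>q m. q \<in> frontier \<Omega> \<Longrightarrow> dist p q < r2 \<Longrightarrow> m \<in> closure \<Omega> \<Longrightarrow> \<epsilon> \<le> dist p m \<Longrightarrow>
       C1_smooth_at \<Omega> q \<and> c \<le> norm (herm (m - q) (?n q))"
    using C_strictly_convex_separation[OF op conv bdd Dini strict \<epsilon>] by blast
  show thesis
  proof (rule that)
    show "min r1 (r2 / 2) > 0" "4 * exp (2 * M) / c > 0" using r1 r2 c by auto
    fix z \<zeta> assume z: "norm z < 1" and \<zeta>: "norm \<zeta> < 1"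
      and near: "dist p (f z) < min r1 (r2 / 2)" and far: "\<epsilon> \<le> dist p (f \<zeta>)"
    obtain q where q: "q \<in> frontier \<Omega>" and nq: "\<And>y. y \<in> frontier \<Omega> \<Longrightarrow> dist (f z) q \<le> dist (f z) y"
      by (rule distance_attains_inf[of "frontier \<Omega>" "f z"]) (use p in auto)
    let ?d = "dist (f z) q"
    have d: "0 < ?d" using f\<Omega>[OF z] q op by (auto simp: frontier_def interior_open)
    have "?d < r2 / 2" using nq[OF p] near by (simp add: dist_commute)
    then have pq: "dist p q < r2" using dist_triangle[of p q "f z"] near by simp
    have clo: "f \<zeta> \<in> closure \<Omega>" using f\<Omega>[OF \<zeta>] closure_subset by blast
    have sm: "C1_smooth_at \<Omega> q" and cl: "c \<le> norm (herm (f \<zeta> - q) (?n q))"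
      using sep[OF q pq clo far] by auto
    have n: "norm (?n q) = 1" using convex_inner_unit_normal(1)[OF op conv sm] .
    obtain L where L: "L \<le> M + ln (1 / ?d) / 2" "disc_chain \<Omega> (f 0) (f z) L"
      using M[OF f\<Omega>[OF z] _ q nq] near by auto
    have "artanh (norm z) \<le> M + ln (1 / ?d) / 2"
      using complex_geodesic_artanh_le[OF geo L(2) z] L(1) by simp
    then have "1 / (1 - norm z) \<le> exp (2 * (M + ln (1 / ?d) / 2))"
      using z by (intro artanh_le_imp) auto
    also have "\<dots> = exp (2 * M) / ?d"
    proof -
      have "2 * (M + ln (1 / ?d) / 2) = 2 * M + ln (1 / ?d)" by simp
      then show ?thesis using d by (simp only: exp_add) simp
    qed
    finally have dle: "?d \<le> exp (2 * M) * (1 - norm z)"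
      using d z by (simp add: field_simps)
    define g where "g u = herm (f u - q) (?n q)" for u
    have "g holomorphic_on ball 0 1"
      unfolding g_def herm_def vector_minus_component by (intro holomorphic_intros fhol)
    moreover have "0 < Re (g u)" if "norm u < 1" for u
      using convex_inner_unit_normal(3)[OF op conv sm f\<Omega>[OF that]] by (simp add: g_def Re_herm)
    moreover have "g z = of_real ?d"
    proof -
      have "f z = q + ?d *\<^sub>R ?n q"
        by (rule nearest_frontier_point_normal[OF op conv f\<Omega>[OF z] q nq sm])
      then have "f z - q = of_real ?d *s ?n q" by (metis add_diff_cancel_left' scaleR_eq_smult)
      then show ?thesis unfolding g_def by (simp only: herm_smult_left herm_self n) simp
    qed
    moreover have "c \<le> norm (g \<zeta>)" using cl by (simp add: g_def)
    ultimately have "(1 - (norm z)\<^sup>2) * (1 - (norm \<zeta>)\<^sup>2) \<le> 4 * ?d / c * (norm (1 - cnj z * \<zeta>))\<^sup>2"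
      using half_plane_Schwarz_Pick z \<zeta> c by blast
    also have "\<dots> \<le> 4 * (exp (2 * M) * (1 - norm z)) / c * (norm (1 - cnj z * \<zeta>))\<^sup>2"
      using dle c by (intro mult_right_mono divide_right_mono) auto
    finally have "(1 - norm z) * ((1 + norm z) * (1 - (norm \<zeta>)\<^sup>2))
        \<le> (1 - norm z) * (4 * exp (2 * M) / c * (norm (1 - cnj z * \<zeta>))\<^sup>2)"
      by (simp add: power2_eq_square algebra_simps)
    then have bound: "(1 + norm z) * (1 - (norm \<zeta>)\<^sup>2) \<le> 4 * exp (2 * M) / c * (norm (1 - cnj z * \<zeta>))\<^sup>2"
      using z by (simp only: mult_le_cancel_left_pos)
    have "1 * (1 - (norm \<zeta>)\<^sup>2) \<le> (1 + norm z) * (1 - (norm \<zeta>)\<^sup>2)"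
      using \<zeta> by (intro mult_right_mono) (auto simp: power_le_one)
    also note bound
    finally show "1 - (norm \<zeta>)\<^sup>2 \<le> 4 * exp (2 * M) / c * (norm (1 - cnj z * \<zeta>))\<^sup>2" by simp
  qed
qed

text \<open>The connecting set goes from \<open>z\<close> radially inwards, across, and radially outwards to \<open>w\<close>;
  the inequalities say that each of its points lies in a thin horodisc based (nearly) at \<open>z\<close> or at \<open>w\<close>.\<close>

lemma connecting_set_near_boundary_point:
  fixes \<xi> :: complex
  assumes \<xi>: "norm \<xi> = 1" and \<kappa>: "\<kappa> > 0"
  obtains d where "d > 0"
    "\<And>z w. norm z < 1 \<Longrightarrow> norm w < 1 \<Longrightarrow> dist \<xi> z < d \<Longrightarrow> dist \<xi> w < d \<Longrightarrow>
      \<exists>K. connected K \<and> K \<subseteq> ball 0 1 \<and> z \<in> K \<and> w \<in> K \<and>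
        (\<forall>\<zeta>\<in>K. (norm (1 - cnj z * \<zeta>))\<^sup>2 < \<kappa> * (1 - (norm \<zeta>)\<^sup>2) \<or>
               (norm (1 - cnj w * \<zeta>))\<^sup>2 < \<kappa> * (1 - (norm \<zeta>)\<^sup>2))"
proof -
  \<comment> \<open>Radially \<open>norm (1 - cnj z * \<zeta>)\<close> is at most
    \<open>6 * d\<close>; across it is at most \<open>8 * d\<close>, against
    \<open>1 - (norm \<zeta>)\<^sup>2 \<ge> 4 * d\<close>, which requires
    \<open>64 * d\<^sup>2 < 4 * \<kappa> * d\<close>. The bound 1/8 keeps \<open>a\<close>
    positive.\<close>
  define d where "d = min (1/8) (\<kappa> / 17)"
  have d: "d > 0" "d \<le> 1/8" "16 * d < \<kappa>" "6 * d < \<kappa>" using \<kappa> by (auto simp: d_def min_def)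
  define a where "a = 1 - 4 * d"
  have a: "0 < a" "a \<le> 1" "1 - a = 4 * d" using d by (auto simp: a_def)
  have sq: "1 - (norm z)\<^sup>2 < 2 * d" if "norm z < 1" "dist \<xi> z < d" for z
  proof -
    have lt: "1 - norm z < d"
      using norm_triangle_ineq2[of \<xi> z] that \<xi> by (simp add: dist_norm)
    have "(1 - norm z) * (1 + norm z) \<le> (1 - norm z) * 2"
      using that by (intro mult_left_mono) auto
    then have "1 - (norm z)\<^sup>2 \<le> 2 - 2 * norm z" by (simp add: power2_eq_square algebra_simps)
    then show ?thesis using lt by linarith
  qed
  have radial: "norm (of_real s * z) < 1 \<and>
      (norm (1 - cnj z * (of_real s * z)))\<^sup>2 < \<kappa> * (1 - (norm (of_real s * z))\<^sup>2)"
    if z: "norm z < 1" "dist \<xi> z < d" and s: "a \<le> s" "s \<le> 1" for s and z :: complex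
  proof -
    let ?m = "(norm z)\<^sup>2"
    have m: "0 \<le> ?m" "?m < 1" using power_strict_mono[OF z(1), of 2] by auto
    have s0: "0 \<le> s" using a s by simp
    have sm1: "s * norm z \<le> 1 * norm z" using s by (intro mult_right_mono) auto
    have "s * s \<le> 1 * s" using s s0 by (intro mult_right_mono) auto
    then have ss: "s\<^sup>2 * ?m \<le> s * ?m" using m by (intro mult_right_mono) (auto simp: power2_eq_square)
    have sm: "s * ?m \<le> 1 * ?m" using s m by (intro mult_right_mono) auto
    have "cnj z * (of_real s * z) = of_real s * (z * cnj z)" by (simp only: mult_ac)
    also have "z * cnj z = of_real ?m" by (metis complex_norm_square)
    finally have "1 - cnj z * (of_real s * z) = of_real (1 - s * ?m)" by simp
    then have e: "norm (1 - cnj z * (of_real s * z)) = 1 - s * ?m"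
      using sm m by (simp only: norm_of_real)
    have "1 - s * ?m = (1 - s) * ?m + (1 - ?m)" by (simp add: algebra_simps)
    also have "(1 - s) * ?m \<le> (1 - s) * 1" using s m by (intro mult_left_mono) auto
    finally have "1 - s * ?m \<le> (1 - s) + (1 - ?m)" by simp
    then have "1 - s * ?m \<le> 6 * d" using sq[OF z] s a by linarith
    then have "(1 - s * ?m)\<^sup>2 \<le> 6 * d * (1 - s * ?m)"
      unfolding power2_eq_square[of "1 - s * ?m"] using sm m by (intro mult_right_mono) auto
    also have "\<dots> < \<kappa> * (1 - s * ?m)" using d sm m by (intro mult_strict_right_mono) auto
    also have "\<dots> \<le> \<kappa> * (1 - s\<^sup>2 * ?m)" using \<kappa> ss by (intro mult_left_mono) auto
    also have "s\<^sup>2 * ?m = (norm (of_real s * z))\<^sup>2" by (simp add: norm_mult power_mult_distrib)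
    finally show ?thesis using e sm1 z s0 by (simp add: norm_mult)
  qed
  have across: "norm (of_real a * u) < 1 \<and>
      (norm (1 - cnj z * (of_real a * u)))\<^sup>2 < \<kappa> * (1 - (norm (of_real a * u))\<^sup>2)"
    if z: "norm z < 1" "dist \<xi> z < d" and w: "norm w < 1" "dist \<xi> w < d" and u: "u \<in> closed_segment z w" for z w u
  proof -
    have "closed_segment z w \<subseteq> ball 0 1 \<inter> ball \<xi> d"
      using z w by (intro closed_segment_subset convex_Int) auto
    then have u1: "norm u < 1" "dist \<xi> u < d" using u by auto
    then have zu: "norm (z - u) < 2 * d"
      using dist_triangle[of z u \<xi>] z(2) by (simp add: dist_norm norm_minus_commute)
    have an: "a * norm u \<le> a * 1" using u1 a by (intro mult_left_mono) auto
    have "1 - cnj z * (of_real a * u) = of_real (1 - a) + of_real a * (of_real (1 - (norm z)\<^sup>2) + cnj z * (z - u))"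
      unfolding of_real_diff complex_norm_square by (simp add: algebra_simps)
    then have "norm (1 - cnj z * (of_real a * u))
        \<le> norm (complex_of_real (1 - a)) + norm (of_real a * (of_real (1 - (norm z)\<^sup>2) + cnj z * (z - u)))"
      by (simp only: norm_triangle_ineq)
    also have "norm (complex_of_real (1 - a)) = 4 * d" using a d by (simp only: norm_of_real)
    also have "norm (of_real a * (of_real (1 - (norm z)\<^sup>2) + cnj z * (z - u)))
        \<le> 1 * norm (of_real (1 - (norm z)\<^sup>2) + cnj z * (z - u))"
      unfolding norm_mult using a by (intro mult_right_mono) auto
    also have "norm (of_real (1 - (norm z)\<^sup>2) + cnj z * (z - u))
        \<le> norm (complex_of_real (1 - (norm z)\<^sup>2)) + norm (cnj z * (z - u))" by (rule norm_triangle_ineq)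
    also have "norm (complex_of_real (1 - (norm z)\<^sup>2)) \<le> 2 * d"
      using sq[OF z] z by (simp only: norm_of_real) (simp add: abs_square_le_1)
    also have "norm (cnj z * (z - u)) \<le> 1 * norm (z - u)"
      unfolding norm_mult using z by (intro mult_right_mono) auto
    finally have "norm (1 - cnj z * (of_real a * u)) \<le> 8 * d" using zu by simp
    then have "(norm (1 - cnj z * (of_real a * u)))\<^sup>2 \<le> (8 * d)\<^sup>2" by (intro power_mono) auto
    also have "\<dots> = 16 * d * (4 * d)" by (simp add: power2_eq_square)
    also have "\<dots> < \<kappa> * (4 * d)" using d by (intro mult_strict_right_mono) auto
    also have "\<dots> \<le> \<kappa> * (1 - (norm (of_real a * u))\<^sup>2)"
    proof -
      have "(norm (of_real a * u))\<^sup>2 \<le> a\<^sup>2"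
        using an a by (intro power_mono) (auto simp: norm_mult)
      also have "a\<^sup>2 \<le> a * 1" unfolding power2_eq_square using a by (intro mult_left_mono) auto
      finally show ?thesis using \<kappa> a by (intro mult_left_mono) auto
    qed
    finally have "(norm (1 - cnj z * (of_real a * u)))\<^sup>2 < \<kappa> * (1 - (norm (of_real a * u))\<^sup>2)" .
    moreover have "a * norm u < 1" using an a(3) d(1) by linarith
    then have "norm (of_real a * u) < 1" using a(1) by (simp add: norm_mult)
    ultimately show ?thesis by blast
  qed
  show thesis
  proof (rule that[OF d(1)])
    fix z w assume z: "norm z < 1" "dist \<xi> z < d" and w: "norm w < 1" "dist \<xi> w < d"
    let ?R = "\<lambda>z::complex. (\<lambda>s. of_real s * z) ` {a..1}"
    let ?A = "(\<lambda>u. of_real a * u) ` closed_segment z w"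
    have R: "connected (?R z)" for z
      by (intro connected_continuous_image continuous_intros) auto
    have A: "connected ?A" by (intro connected_continuous_image continuous_intros) auto
    have "of_real a * z \<in> ?R z" "of_real a * w \<in> ?R w" "of_real a * z \<in> ?A" "of_real a * w \<in> ?A"
      using a by auto
    then have "connected ((?R z \<union> ?A) \<union> ?R w)"
      by (intro connected_Un R A) blast+
    moreover have "z \<in> ?R z" "w \<in> ?R w" using a by (auto intro!: image_eqI[of _ _ 1])
    ultimately show "\<exists>K. connected K \<and> K \<subseteq> ball 0 1 \<and> z \<in> K \<and> w \<in> K \<and>
        (\<forall>\<zeta>\<in>K. (norm (1 - cnj z * \<zeta>))\<^sup>2 < \<kappa> * (1 - (norm \<zeta>)\<^sup>2) \<or>
               (norm (1 - cnj w * \<zeta>))\<^sup>2 < \<kappa> * (1 - (norm \<zeta>)\<^sup>2))"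
      using radial[OF z] radial[OF w] across[OF z w]
      by (intro exI[of _ "(?R z \<union> ?A) \<union> ?R w"]) auto
  qed
qed

text \<open>The image of a connecting set meets disjoint balls about \<open>p\<close> and
  \<open>q\<close>, so it contains some \<open>f \<zeta>\<close> outside both. Then the separation
  estimates at \<open>p\<close> and at \<open>q\<close> both apply to \<open>\<zeta>\<close>,
  whereas \<open>\<zeta>\<close> lies in one of the two horodiscs.\<close>

lemma geodesic_cluster_points_eq:
  fixes \<Omega> :: "(complex ^ 'n) set"
  assumes op: "open \<Omega>" and conv: "convex \<Omega>" and bdd: "bounded \<Omega>" and geo: "complex_geodesic \<Omega> f"
    and p: "C1_Dini_smooth_at \<Omega> p" "C_strictly_convex_at \<Omega> p"
    and q: "C1_Dini_smooth_at \<Omega> q" "C_strictly_convex_at \<Omega> q"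
    and \<xi>: "norm \<xi> = 1"
    and clp: "\<And>d \<epsilon>. d > 0 \<Longrightarrow> \<epsilon> > 0 \<Longrightarrow> \<exists>z. norm z < 1 \<and> dist \<xi> z < d \<and> dist p (f z) < \<epsilon>"
    and clq: "\<And>d \<epsilon>. d > 0 \<Longrightarrow> \<epsilon> > 0 \<Longrightarrow> \<exists>z. norm z < 1 \<and> dist \<xi> z < d \<and> dist q (f z) < \<epsilon>"
  shows "p = q"
proof (rule ccontr)
  assume "p \<noteq> q"
  define \<epsilon> where "\<epsilon> = dist p q / 2"
  have \<epsilon>: "\<epsilon> > 0" using \<open>p \<noteq> q\<close> by (simp add: \<epsilon>_def)
  obtain r C where r: "r > 0" and C: "C > 0"
    and est: "\<And>z \<zeta>. norm z < 1 \<Longrightarrow> norm \<zeta> < 1 \<Longrightarrow> dist p (f z) < r \<Longrightarrow> \<epsilon> \<le> dist p (f \<zeta>) \<Longrightarrow>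
       1 - (norm \<zeta>)\<^sup>2 \<le> C * (norm (1 - cnj z * \<zeta>))\<^sup>2"
    using geodesic_separation_estimate[OF op conv bdd geo p \<epsilon>] by blast
  obtain r' C' where r': "r' > 0" and C': "C' > 0"
    and est': "\<And>z \<zeta>. norm z < 1 \<Longrightarrow> norm \<zeta> < 1 \<Longrightarrow> dist q (f z) < r' \<Longrightarrow> \<epsilon> \<le> dist q (f \<zeta>) \<Longrightarrow>
       1 - (norm \<zeta>)\<^sup>2 \<le> C' * (norm (1 - cnj z * \<zeta>))\<^sup>2"
    using geodesic_separation_estimate[OF op conv bdd geo q \<epsilon>] by blast
  \<comment> \<open>Small enough to contradict either estimate, whichever horodisc contains
    \<open>\<zeta>\<close>.\<close>
  define \<kappa> where "\<kappa> = 1 / (C + C')"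
  have \<kappa>: "\<kappa> > 0" "C * \<kappa> \<le> 1" "C' * \<kappa> \<le> 1" using C C' by (auto simp: \<kappa>_def divide_simps)
  obtain d where d: "d > 0" and conn:
    "\<And>z w. norm z < 1 \<Longrightarrow> norm w < 1 \<Longrightarrow> dist \<xi> z < d \<Longrightarrow> dist \<xi> w < d \<Longrightarrow>
      \<exists>K. connected K \<and> K \<subseteq> ball 0 1 \<and> z \<in> K \<and> w \<in> K \<and>
        (\<forall>\<zeta>\<in>K. (norm (1 - cnj z * \<zeta>))\<^sup>2 < \<kappa> * (1 - (norm \<zeta>)\<^sup>2) \<or>
               (norm (1 - cnj w * \<zeta>))\<^sup>2 < \<kappa> * (1 - (norm \<zeta>)\<^sup>2))"
    using connecting_set_near_boundary_point[OF \<xi> \<kappa>(1)] by blast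
  obtain z where z: "norm z < 1" "dist \<xi> z < d" "dist p (f z) < min r \<epsilon>"
    using clp[OF d, of "min r \<epsilon>"] r \<epsilon> by auto
  obtain w where w: "norm w < 1" "dist \<xi> w < d" "dist q (f w) < min r' \<epsilon>"
    using clq[OF d, of "min r' \<epsilon>"] r' \<epsilon> by auto
  obtain K where K: "connected K" "K \<subseteq> ball 0 1" "z \<in> K" "w \<in> K"
    and K': "\<And>\<zeta>. \<zeta> \<in> K \<Longrightarrow> (norm (1 - cnj z * \<zeta>))\<^sup>2 < \<kappa> * (1 - (norm \<zeta>)\<^sup>2) \<or>
               (norm (1 - cnj w * \<zeta>))\<^sup>2 < \<kappa> * (1 - (norm \<zeta>)\<^sup>2)"
    using conn[OF z(1) w(1) z(2) w(2)] by blast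
  have "continuous_on (ball 0 1) f"
    using geo by (intro holomorphic_disc_continuous) (auto simp: complex_geodesic_def)
  then have fK: "connected (f ` K)"
    using K by (intro connected_continuous_image) (auto intro: continuous_on_subset)
  have disj: "ball p \<epsilon> \<inter> ball q \<epsilon> = {}" by (rule disjoint_ballI) (simp add: \<epsilon>_def)
  have "\<not> f ` K \<subseteq> ball p \<epsilon> \<union> ball q \<epsilon>"
  proof
    assume "f ` K \<subseteq> ball p \<epsilon> \<union> ball q \<epsilon>"
    then have "ball p \<epsilon> \<inter> f ` K = {} \<or> ball q \<epsilon> \<inter> f ` K = {}"
      using connectedD[OF fK open_ball open_ball] disj by blast
    then show False using K z w by auto
  qed
  then obtain \<zeta> where "\<zeta> \<in> K" "f \<zeta> \<notin> ball p \<epsilon> \<union> ball q \<epsilon>" by blast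
  then have \<zeta>: "\<zeta> \<in> K" "\<epsilon> \<le> dist p (f \<zeta>)" "\<epsilon> \<le> dist q (f \<zeta>)" by auto
  have n\<zeta>: "norm \<zeta> < 1" using \<zeta> K by auto
  then have pos: "0 < 1 - (norm \<zeta>)\<^sup>2" by (simp add: abs_square_less_1)
  from K'[OF \<zeta>(1)] show False
  proof
    assume "(norm (1 - cnj z * \<zeta>))\<^sup>2 < \<kappa> * (1 - (norm \<zeta>)\<^sup>2)"
    then have "C * (norm (1 - cnj z * \<zeta>))\<^sup>2 < C * (\<kappa> * (1 - (norm \<zeta>)\<^sup>2))" using C by simp
    also have "\<dots> = (C * \<kappa>) * (1 - (norm \<zeta>)\<^sup>2)" by simp
    also have "\<dots> \<le> 1 * (1 - (norm \<zeta>)\<^sup>2)" using \<kappa> pos by (intro mult_right_mono) auto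
    finally show False using est[OF z(1) n\<zeta> _ \<zeta>(2)] z(3) by simp
  next
    assume "(norm (1 - cnj w * \<zeta>))\<^sup>2 < \<kappa> * (1 - (norm \<zeta>)\<^sup>2)"
    then have "C' * (norm (1 - cnj w * \<zeta>))\<^sup>2 < C' * (\<kappa> * (1 - (norm \<zeta>)\<^sup>2))" using C' by simp
    also have "\<dots> = (C' * \<kappa>) * (1 - (norm \<zeta>)\<^sup>2)" by simp
    also have "\<dots> \<le> 1 * (1 - (norm \<zeta>)\<^sup>2)" using \<kappa> pos by (intro mult_right_mono) auto
    finally show False using est'[OF w(1) n\<zeta> _ \<zeta>(3)] w(3) by simp
  qed
qed

section \<open>Boundary extension\<close>

text \<open>On the open complement of its limit points \<open>S\<close> is sparse, hence countable
  there; the limit points add a finite set.\<close>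

lemma countable_if_finite_limit_points:
  fixes S :: "'a::euclidean_space set"
  assumes "finite {x. x islimpt S}"
  shows "countable S"
proof -
  let ?L = "{x. x islimpt S}"
  have op: "open (- ?L)" using finite_imp_closed[OF assms] by (simp add: open_Compl)
  have "S sparse_in (- ?L)"
    unfolding sparse_in_def by (intro ballI exI[of _ "- ?L"]) (simp add: op)
  then have "countable (- ?L \<inter> S)" by (rule sparse_imp_countable[OF op])
  then have "countable ((- ?L \<inter> S) \<union> ?L)" using countable_finite[OF assms] by (rule countable_Un)
  then show ?thesis by (rule countable_subset[rotated]) auto
qed

text \<open>A Lebesgue number argument. The condition compares only values of \<open>f\<close> on
  \<open>X\<close>, so no boundary value has to be known in advance.\<close>

lemma uniformly_continuous_onI_cover:
  fixes f :: "'a::heine_borel \<Rightarrow> 'b::metric_space"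
  assumes "compact K" "X \<subseteq> K"
    and osc: "\<And>\<xi> \<epsilon>. \<xi> \<in> K \<Longrightarrow> \<epsilon> > 0 \<Longrightarrow>
      \<exists>d>0. \<forall>z\<in>X \<inter> ball \<xi> d. \<forall>w\<in>X \<inter> ball \<xi> d. dist (f z) (f w) < \<epsilon>"
  shows "uniformly_continuous_on X f"
  unfolding uniformly_continuous_on_def
proof (intro allI impI)
  fix \<epsilon> :: real assume "\<epsilon> > 0"
  then have "\<forall>\<xi>\<in>K. \<exists>d>0. \<forall>z\<in>X \<inter> ball \<xi> d. \<forall>w\<in>X \<inter> ball \<xi> d. dist (f z) (f w) < \<epsilon>"
    using osc by blast
  from bchoice[OF this] obtain d where d: "\<And>\<xi>. \<xi> \<in> K \<Longrightarrow> d \<xi> > 0"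
    "\<And>\<xi> z w. \<xi> \<in> K \<Longrightarrow> z \<in> X \<inter> ball \<xi> (d \<xi>) \<Longrightarrow> w \<in> X \<inter> ball \<xi> (d \<xi>) \<Longrightarrow> dist (f z) (f w) < \<epsilon>"
    by blast
  have "K \<subseteq> \<Union> ((\<lambda>\<xi>. ball \<xi> (d \<xi>)) ` K)" using d(1) by force
  then obtain e where e: "e > 0" "\<And>x. x \<in> K \<Longrightarrow> \<exists>G\<in>(\<lambda>\<xi>. ball \<xi> (d \<xi>)) ` K. ball x e \<subseteq> G"
    using Heine_Borel_lemma[OF assms(1), of "(\<lambda>\<xi>. ball \<xi> (d \<xi>)) ` K"] by blast
  show "\<exists>e>0. \<forall>x\<in>X. \<forall>x'\<in>X. dist x' x < e \<longrightarrow> dist (f x') (f x) < \<epsilon>"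
  proof (intro exI[of _ e] conjI ballI impI e(1))
    fix x x' assume x: "x \<in> X" "x' \<in> X" "dist x' x < e"
    then obtain \<xi> where \<xi>: "\<xi> \<in> K" "ball x e \<subseteq> ball \<xi> (d \<xi>)" using e(2) assms(2) by blast
    have "x \<in> ball x e" "x' \<in> ball x e" using x e(1) by (auto simp: dist_commute)
    with \<xi>(2) x show "dist (f x') (f x) < \<epsilon>" by (intro d(2)[OF \<xi>(1)] IntI) blast+
  qed
qed

theorem corollary1p12:
  fixes \<Omega> S :: "(complex ^ 'n) set"
    and f :: "complex \<Rightarrow> complex ^ 'n"
  assumes "open \<Omega>" and "convex \<Omega>" and "bounded \<Omega>" and "\<Omega> \<noteq> {}"
    and "compact S" and "S \<subseteq> frontier \<Omega>"
    and "finite {x. x islimpt S}"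
    and "\<And>p. p \<in> frontier \<Omega> - S \<Longrightarrow> C1_Dini_smooth_at \<Omega> p \<and> C_strictly_convex_at \<Omega> p"
    and "complex_geodesic \<Omega> f"
  shows "\<exists>F. continuous_on (cball 0 1) F \<and> (\<forall>z\<in>ball 0 1. F z = f z)"
proof -
  note op = assms(1) and conv = assms(2) and bdd = assms(3) and geo = assms(9)
  have f\<Omega>: "f z \<in> \<Omega>" if "norm z < 1" for z
    using geo that by (auto simp: complex_geodesic_def holomorphic_disc_def)
  have cont: "continuous_on (ball 0 1) f"
    using geo by (intro holomorphic_disc_continuous) (auto simp: complex_geodesic_def)
  have oscillation: "\<exists>d>0. \<forall>z\<in>ball 0 1 \<inter> ball \<xi> d. \<forall>w\<in>ball 0 1 \<inter> ball \<xi> d. dist (f z) (f w) < \<epsilon>"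
    if \<epsilon>: "\<epsilon> > 0" and \<xi>: "norm \<xi> = 1" for \<epsilon> \<xi>
  proof -
    \<comment> \<open>The intersection of these sets is the cluster set of \<open>f\<close> at
      \<open>\<xi>\<close>. Taking closures of images of convex sets makes it a nested intersection
      of compact connected sets.\<close>
    define G where "G n = closure (f ` (ball 0 1 \<inter> ball \<xi> (inverse (real (Suc n)))))" for n
    have sub: "f ` (ball 0 1 \<inter> ball \<xi> d) \<subseteq> \<Omega>" for d using f\<Omega> by auto
    have Gc: "compact (G n)" for n
      unfolding G_def using bounded_subset[OF bdd sub] by (simp add: compact_closure)
    have Gconn: "connected (G n)" for n
      unfolding G_def
      by (intro connected_imp_connected_closure connected_continuous_image convex_connected convex_Int convex_ball
          continuous_on_subset[OF cont]) auto
    have Gnest: "G n \<subseteq> G m" if "m \<le> n" for m n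
      unfolding G_def using that
      by (intro closure_mono image_mono Int_mono subset_ball le_imp_inverse_le) auto
    have cluster: "\<exists>z. norm z < 1 \<and> dist \<xi> z < d \<and> dist p (f z) < e"
      if p: "p \<in> \<Inter> (range G)" and "d > 0" "e > 0" for p d e
    proof -
      obtain n where n: "inverse (real (Suc n)) < d" using reals_Archimedean[OF \<open>d > 0\<close>] by blast
      have "p \<in> G n" using p by blast
      then obtain z where "z \<in> ball 0 1 \<inter> ball \<xi> (inverse (real (Suc n)))" "dist (f z) p < e"
        unfolding G_def closure_approachable using \<open>e > 0\<close> by blast
      then show ?thesis using n by (intro exI[of _ z]) (auto simp: dist_commute)
    qed
    have frontier: "p \<in> frontier \<Omega>" if p: "p \<in> \<Inter> (range G)" for p
    proof -
      \<comment> \<open>Properness: chains from \<open>f 0\<close> to points near an interior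
        \<open>p\<close> have length at most \<open>M\<close>, which keeps \<open>z\<close> at
        distance at least \<open>exp (- 2 * M)\<close> from the circle.\<close>
      have "p \<notin> \<Omega>"
      proof
        assume "p \<in> \<Omega>"
        then obtain e where e: "e > 0" "cball p e \<subseteq> \<Omega>" using op open_contains_cball by blast
        obtain M where M: "\<And>x. x \<in> cball p e \<Longrightarrow> \<exists>L\<le>M. disc_chain \<Omega> (f 0) x L"
          using disc_chain_compact_bound[OF op convex_connected[OF conv] f\<Omega>[of 0] compact_cball e(2)] by (metis norm_zero zero_less_one)
        obtain z where z: "norm z < 1" "dist \<xi> z < exp (- 2 * M)" "dist p (f z) < e"
          using cluster[OF p, of "exp (- 2 * M)" e] e by auto
        obtain L where L: "L \<le> M" "disc_chain \<Omega> (f 0) (f z) L" using M[of "f z"] z by auto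
        have "artanh (norm z) \<le> M" using complex_geodesic_artanh_le[OF geo L(2) z(1)] L(1) by simp
        then have "1 / (1 - norm z) \<le> exp (2 * M)" using z by (intro artanh_le_imp) auto
        then have "exp (- 2 * M) \<le> 1 - norm z" using z by (simp add: exp_minus field_simps)
        moreover have "1 - norm z \<le> dist \<xi> z"
          using norm_triangle_ineq2[of \<xi> z] \<xi> by (simp add: dist_norm)
        ultimately show False using z by simp
      qed
      moreover have "p \<in> closure \<Omega>" using p closure_mono[OF sub] unfolding G_def by blast
      ultimately show ?thesis using op by (simp add: frontier_def interior_open)
    qed
    have "\<exists>P. \<Inter> (range G) \<subseteq> {P}"
    proof (rule ccontr)
      assume no: "\<not> ?thesis"
      have conn: "connected (\<Inter> (range G))" by (rule connected_nest[OF Gc Gconn Gnest])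
      have "\<Inter> (range G) \<noteq> {}" using no by (metis empty_subsetI)
      then obtain P where P: "P \<in> \<Inter> (range G)" by (meson ex_in_conv)
      have "\<not> \<Inter> (range G) \<subseteq> {P}" using no by (rule contrapos_nn) (rule exI)
      then obtain Q where Q: "Q \<in> \<Inter> (range G)" "P \<noteq> Q" by (metis singletonI subsetI)
      \<comment> \<open>A connected set with two points is uncountable, so removing the countable
        \<open>S\<close> still leaves two cluster values at which the boundary hypotheses
        hold.\<close>
      have unc: "uncountable (\<Inter> (range G) - S)"
        by (rule uncountable_minus_countable[OF connected_uncountable[OF conn P Q]
              countable_if_finite_limit_points[OF assms(7)]])
      then have "\<Inter> (range G) - S \<noteq> {}" by (metis countable_empty)
      then obtain p where p: "p \<in> \<Inter> (range G) - S" by (meson ex_in_conv)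
      have "\<not> \<Inter> (range G) - S \<subseteq> {p}"
        using unc countable_subset[of _ "{p}"] by (metis countable_insert countable_empty)
      then obtain q where q: "q \<in> \<Inter> (range G) - S" "q \<noteq> p" by (metis singletonI subsetI)
      have "p = q"
        using assms(8)[of p] assms(8)[of q] p q(1) frontier
        by (intro geodesic_cluster_points_eq[OF op conv bdd geo _ _ _ _ \<xi> cluster cluster]) auto
      then show False using q by simp
    qed
    then obtain P where P: "\<Inter> (range G) \<subseteq> {P}" by blast
    \<comment> \<open>Otherwise the nonempty compact sets
      \<open>G n - ball P (\<epsilon> / 2)\<close> would have a common point, a cluster value other
      than \<open>P\<close>.\<close>
    obtain n where n: "G n \<subseteq> ball P (\<epsilon> / 2)"
    proof (rule ccontr)
      assume "\<not> thesis"
      then have ne: "G n - ball P (\<epsilon> / 2) \<noteq> {}" for n using that by blast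
      have "\<Inter> (range (\<lambda>n. G n - ball P (\<epsilon> / 2))) \<noteq> {}"
      proof (rule compact_nest)
        show "G n - ball P (\<epsilon> / 2) \<subseteq> G m - ball P (\<epsilon> / 2)" if "m \<le> n" for m n
          using Gnest[OF that] by blast
      qed (use Gc ne in \<open>auto intro!: compact_diff\<close>)
      then show False using P \<epsilon> by auto
    qed
    show ?thesis
    proof (intro exI[of _ "inverse (real (Suc n))"] conjI ballI)
      fix z w assume zw: "z \<in> ball 0 1 \<inter> ball \<xi> (inverse (real (Suc n)))"
        "w \<in> ball 0 1 \<inter> ball \<xi> (inverse (real (Suc n)))"
      then have "f z \<in> G n" "f w \<in> G n" 
        unfolding G_def by (auto intro!: subsetD[OF closure_subset] imageI)
      then have "dist (f z) P < \<epsilon> / 2" "dist (f w) P < \<epsilon> / 2" using n by (auto simp: dist_commute)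
      then show "dist (f z) (f w) < \<epsilon>" using dist_triangle_half_l by blast
    qed simp
  qed
  have uc: "uniformly_continuous_on (ball 0 1) f"
  proof (rule uniformly_continuous_onI_cover[OF compact_cball ball_subset_cball])
    fix \<xi> :: complex and \<epsilon> :: real assume \<xi>: "\<xi> \<in> cball 0 1" and \<epsilon>: "\<epsilon> > 0"
    show "\<exists>d>0. \<forall>z\<in>ball 0 1 \<inter> ball \<xi> d. \<forall>w\<in>ball 0 1 \<inter> ball \<xi> d. dist (f z) (f w) < \<epsilon>"
    proof (cases "norm \<xi> = 1")
      case True
      then show ?thesis by (rule oscillation[OF \<epsilon>])
    next
      case False
      then have "\<xi> \<in> ball 0 1" using \<xi> by simp
      then obtain d where d: "d > 0" "\<And>z. z \<in> ball 0 1 \<Longrightarrow> dist z \<xi> < d \<Longrightarrow> dist (f z) (f \<xi>) < \<epsilon> / 2"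
        using cont \<epsilon> unfolding continuous_on_iff by (metis half_gt_zero)
      show ?thesis
      proof (intro exI[of _ d] conjI ballI d(1))
        fix z w assume "z \<in> ball 0 1 \<inter> ball \<xi> d" "w \<in> ball 0 1 \<inter> ball \<xi> d"
        then have "dist (f z) (f \<xi>) < \<epsilon> / 2" "dist (f w) (f \<xi>) < \<epsilon> / 2"
          using d(2)[of z] d(2)[of w] by (auto simp: dist_commute)
        then show "dist (f z) (f w) < \<epsilon>" using dist_triangle_half_l by blast
      qed
    qed
  qed
  obtain F where "uniformly_continuous_on (closure (ball 0 1)) F" "\<And>z. z \<in> ball 0 1 \<Longrightarrow> f z = F z"
    by (rule uniformly_continuous_on_extension_on_closure[OF uc]) (rule that)
  then show ?thesis
    using uniformly_continuous_imp_continuous by (intro exI[of _ F]) auto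
qed

end
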